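(* Let $\mathbb{F}$ be a field, and let $U$ and $V$ be finite-dimensional vector spaces over $\mathbb{F}$ with $\dim U = p$, $\dim V = n$ and $p \geq n$. Let $\mathcal{S}$ be an affine subspace of $\operatorname{Hom}(U,V)$ that contains no operator of rank $n$ (i.e. no surjective operator). Then $\dim \mathcal{S} \leq p(n-1)$. Moreover, if $\dim \mathcal{S} = p(n-1)$, then at least one of the following holds: (i) there is a linear hyperplane $H$ of $V$ that includes the range of every operator in $\mathcal{S}$; (ii) $n=p$ and there is a non-zero vector $x \in U$ such that $u(x)=0$ for all $u \in \mathcal{S}$; (iii) $n=p=|\mathbb{F}|=2$ and $\mathcal{S}$ is not a linear subspace of $\operatorname{Hom}(U,V)$.
   Context: $\operatorname{Hom}(U,V)$ is the $\mathbb{F}$-vector space of all $\mathbb{F}$-linear maps (operators) from $U$ to $V$. The field $\mathbb{F}$ is arbitrary (possibly finite). An affine subspace of $\operatorname{Hom}(U,V)$ is a (nonempty) subset of the form $a + S$ with $a \in \operatorname{Hom}(U,V)$ and $S$ a linear subspace of $\operatorname{Hom}(U,V)$ (its translation vector space); its dimension is $\dim S$. A linear hyperplane of $V$ is a linear subspace of codimension $1$. *)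

theory Defs
  imports Complex_Main "HOL-Library.Function_Algebras"
begin

text \<open>
  Vector spaces are rendered by the locales of \<^theory>\<open>HOL.Vector_Spaces\<close>: a vector space is a type of
  class \<^class>\<open>ab_group_add\<close> with a scalar multiplication by a \<^class>\<open>field\<close>. Maps between them form an
  additive group pointwise by \<^theory>\<open>HOL-Library.Function_Algebras\<close>.
\<close>

definition fun_scale :: "('f \<Rightarrow> 'v \<Rightarrow> 'v) \<Rightarrow> 'f \<Rightarrow> ('u \<Rightarrow> 'v) \<Rightarrow> 'u \<Rightarrow> 'v"
  where "fun_scale sV c u = (\<lambda>x. sV c (u x))"

lemma vector_space_fun_scale:
  fixes sV :: "'f::field \<Rightarrow> 'v::ab_group_add \<Rightarrow> 'v"
  assumes "vector_space sV"
  shows "vector_space (fun_scale sV :: 'f \<Rightarrow> ('u \<Rightarrow> 'v) \<Rightarrow> 'u \<Rightarrow> 'v)"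
proof -
  interpret vector_space sV by fact
  show ?thesis
    by unfold_locales (auto simp: fun_scale_def fun_eq_iff scale_right_distrib scale_left_distrib)
qed

definition Hom :: "('f::field \<Rightarrow> 'u::ab_group_add \<Rightarrow> 'u) \<Rightarrow> ('f \<Rightarrow> 'v::ab_group_add \<Rightarrow> 'v)
    \<Rightarrow> ('u \<Rightarrow> 'v) set"
  where "Hom sU sV = {u. Vector_Spaces.linear sU sV u}"

lemma subspace_Hom:
  assumes "vector_space sU" "vector_space sV"
  shows "module.subspace (fun_scale sV) (Hom sU sV)"
proof -
  interpret U: vector_space sU by fact
  interpret V: vector_space sV by fact
  interpret P: vector_space_pair sU sV ..
  interpret F: vector_space "fun_scale sV :: _ \<Rightarrow> ('b \<Rightarrow> 'c) \<Rightarrow> _"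
    by (rule vector_space_fun_scale) fact
  show ?thesis
    by (rule F.subspaceI)
       (auto simp: Hom_def fun_scale_def plus_fun_def zero_fun_def
             intro: P.linear_zero P.linear_compose_add P.linear_compose_scale_right)
qed

text \<open>
  Affine subspaces of a linear subspace \<open>E\<close> of the space with scalar multiplication \<open>s\<close>; they are
  nonempty, as \<open>T\<close> contains \<open>0\<close>. Their translation space and dimension do not depend on \<open>E\<close>.
\<close>

definition affine_subspace_of :: "('f::field \<Rightarrow> 'a::ab_group_add \<Rightarrow> 'a) \<Rightarrow> 'a set \<Rightarrow> 'a set \<Rightarrow> bool"
  where "affine_subspace_of s E A \<longleftrightarrow>
    (\<exists>a\<in>E. \<exists>T. T \<subseteq> E \<and> module.subspace s T \<and> A = (+) a ` T)"

definition translation_space :: "('f::field \<Rightarrow> 'a::ab_group_add \<Rightarrow> 'a) \<Rightarrow> 'a set \<Rightarrow> 'a set"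
  where "translation_space s A = (THE T. module.subspace s T \<and> (\<exists>a. A = (+) a ` T))"

definition affine_dim :: "('f::field \<Rightarrow> 'a::ab_group_add \<Rightarrow> 'a) \<Rightarrow> 'a set \<Rightarrow> nat"
  where "affine_dim s A = vector_space.dim s (translation_space s A)"

lemma translation_space_eq:
  assumes "vector_space s" "module.subspace s T"
  shows "translation_space s ((+) a ` T) = T"
  unfolding translation_space_def
proof (rule the_equality)
  show "module.subspace s T \<and> (\<exists>b. (+) a ` T = (+) b ` T)"
    using assms(2) by blast
next
  interpret vector_space s by fact
  have T: "subspace T" by fact
  fix T' assume "subspace T' \<and> (\<exists>b. (+) a ` T = (+) b ` T')"
  then obtain b where T': "subspace T'" and eq: "(+) a ` T = (+) b ` T'" by blast
  have diff: "x \<in> (\<lambda>(y, z). y - z) ` ((+) c ` S \<times> (+) c ` S) \<longleftrightarrow> x \<in> S" if S: "subspace S" for c x S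
  proof
    assume "x \<in> (\<lambda>(y, z). y - z) ` ((+) c ` S \<times> (+) c ` S)"
    then show "x \<in> S" using subspace_diff[OF S] by auto
  next
    assume "x \<in> S"
    then have "c + x \<in> (+) c ` S" "c + 0 \<in> (+) c ` S" using subspace_0[OF S] by auto
    then show "x \<in> (\<lambda>(y, z). y - z) ` ((+) c ` S \<times> (+) c ` S)"
      by (intro image_eqI[of _ _ "(c + x, c + 0)"]) auto
  qed
  show "T' = T"
    using diff[OF T, of _ a] diff[OF T', of _ b] unfolding eq by blast
qed

definition linear_hyperplane :: "('f::field \<Rightarrow> 'v::ab_group_add \<Rightarrow> 'v) \<Rightarrow> 'v set \<Rightarrow> bool"
  where "linear_hyperplane s H \<longleftrightarrow>
    module.subspace s H \<and> vector_space.dim s H + 1 = vector_space.dim s UNIV"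

end

theory Submission imports Defs begin

text \<open>
  Write \<open>\<S> = a + T\<close>. Over a basis of \<open>U\<close>, operators are tuples of \<open>p\<close> vectors of \<open>V\<close> (the columns of a
  matrix), and surjectivity means that the columns span \<open>V\<close>. The claim is that \<open>T\<close> has codimension
  at least \<open>p\<close>, with a description of the case of codimension exactly \<open>p\<close>.

  The engine is the deletion of a column and a row (\<open>column_reduction\<close>). Suppose that
  \<open>{t x | t \<in> T} = V\<close> for some \<open>x\<close>. For each nonzero \<open>y\<close>, the members \<open>u\<close> of \<open>\<S>\<close> with \<open>u x = y\<close> induce
  an affine space of maps \<open>U / x \<rightarrow> V / y\<close>, none of them surjective. Induction bounds its dimension;
  what is lost on the way is the slice of those \<open>t \<in> T\<close> that kill \<open>x\<close> and have range in the line of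
  \<open>y\<close>, and this slice must therefore be large, for every \<open>y\<close>. If \<open>T\<close> had codimension less than \<open>p\<close>, such
  an \<open>x\<close> would exist and all slices would be full, which makes \<open>T\<close> everything (\<open>codim_bound\<close>).

  In codimension exactly \<open>p\<close> there are two cases. If no such \<open>x\<close> exists, \<open>T\<close> is a product of
  hyperplanes over any basis of \<open>U\<close>; they have to coincide, and this leads to outcome (i)
  (\<open>extremal_without_onto_vector\<close>). If \<open>x\<close> exists, each slice has codimension at most one in
  the operators that kill \<open>x\<close> and have range in the line of \<open>y\<close>, and a count over a basis of \<open>V\<close> gives
  \<open>n = p\<close> together with one vector \<open>z\<close> such that
  \<open>T\<close> contains every operator that kills \<open>x\<close> and \<open>z\<close> (\<open>kernel_is_functional\<close>). Hence
  \<open>\<S> = {u. u z = v0 + \<beta> (u x)}\<close> for some \<open>v0 \<in> V\<close> and some endomorphism \<open>\<beta>\<close> of \<open>V\<close>. Such a \<open>u\<close> can be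
  chosen bijective as soon as some \<open>w\<close> is linearly independent of \<open>v0 + \<beta> w\<close>. If this never happens,
  then either \<open>v0 = 0\<close> and \<open>\<beta>\<close> is a scalar \<open>k\<close>, so that \<open>z - k x\<close> is a common kernel vector (outcome
  (ii)), or \<open>v0 \<noteq> 0\<close>, \<open>n = 2\<close> and the field has two elements (outcome (iii); see
  \<open>scalar_or_two_elements\<close>).
\<close>

section \<open>Dimension and rank for finitely generated subspaces\<close>

text \<open>
  Spaces of functions over an arbitrary index type need not be finite-dimensional, so finiteness is a
  property of subspaces here and not of the ambient type. A locale of its own keeps these facts out of
  the existing interpretations of \<^locale>\<open>vector_space\<close>.
\<close>
locale vect = vector_space scale for scale :: "'f::field \<Rightarrow> 'v::ab_group_add \<Rightarrow> 'v"
begin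

definition fin_gen :: "'v set \<Rightarrow> bool"
  where "fin_gen T \<longleftrightarrow> (\<exists>G. finite G \<and> T \<subseteq> span G)"

lemma fin_gen_mono: "fin_gen T \<Longrightarrow> S \<subseteq> T \<Longrightarrow> fin_gen S"
  unfolding fin_gen_def by blast

lemma independent_le_dim:
  assumes "fin_gen T" "B \<subseteq> T" "independent B"
  shows "finite B" "card B \<le> dim T"
proof -
  obtain G where G: "finite G" "T \<subseteq> span G" using assms(1) unfolding fin_gen_def by blast
  obtain C where C: "B \<subseteq> C" "C \<subseteq> T" "independent C" "T \<subseteq> span C"
    using maximal_independent_subset_extend[OF assms(2,3)] by blast
  have "finite C" using independent_span_bound[OF G(1) C(3)] C(2) G(2) by blast
  moreover have "card C = dim T" using basis_card_eq_dim C by blast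
  ultimately show "finite B" "card B \<le> dim T"
    using C(1) finite_subset card_mono by metis+
qed

lemma fin_gen_basis:
  assumes "subspace T" "fin_gen T"
  obtains B where "finite B" "B \<subseteq> T" "independent B" "span B = T" "card B = dim T"
  by (metis assms basis_exists independent_le_dim(1) span_subspace)

lemma dim_mono_fin_gen: "fin_gen T \<Longrightarrow> S \<subseteq> T \<Longrightarrow> dim S \<le> dim T"
  by (metis basis_exists independent_le_dim(2) subset_trans)

lemma subspace_eq_of_dim_le:
  assumes "subspace S" "fin_gen T" "S \<subseteq> T" "dim T \<le> dim S"
  shows "S = T"
proof -
  obtain B where B: "finite B" "B \<subseteq> S" "independent B" "span B = S" "card B = dim S"
    using fin_gen_basis[OF assms(1) fin_gen_mono[OF assms(2,3)]] by blast
  have "x \<in> span B" if x: "x \<in> T" for x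
  proof (rule ccontr)
    assume nx: "x \<notin> span B"
    then have "independent (insert x B)" "x \<notin> B" using independent_insertI[OF nx B(3)] span_base by auto
    then have "card (insert x B) \<le> dim T"
      using x B(2) assms(3) by (intro independent_le_dim(2)[OF assms(2)]) auto
    then show False using B assms(4) \<open>x \<notin> B\<close> by simp
  qed
  then show ?thesis using B(4) assms(3) by blast
qed

text \<open>
  Working modulo a hyperplane \<open>C\<close> of \<open>E\<close>: every vector is a multiple of one fixed vector outside \<open>C\<close>.
\<close>
lemma hyperplane_decomp:
  assumes "subspace C" "fin_gen E" "C \<subseteq> E" "dim E \<le> dim C + 1" "e \<in> E" "e \<notin> C" "x \<in> E"
  obtains k where "x - scale k e \<in> C"
proof -
  obtain B where B: "finite B" "B \<subseteq> C" "independent B" "span B = C" "card B = dim C"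
    using fin_gen_basis[OF assms(1) fin_gen_mono[OF assms(2,3)]] by blast
  have i: "independent (insert e B)" "e \<notin> B"
    using B assms(6) independent_insertI[of e B] by auto
  have "x \<in> span (insert e B)"
  proof (rule ccontr)
    assume nx: "x \<notin> span (insert e B)"
    then have "independent (insert x (insert e B))" "x \<notin> insert e B"
      using independent_insertI[OF nx i(1)] span_base by auto
    then have "card (insert x (insert e B)) \<le> dim E"
      using assms(3,5,7) B(2) by (intro independent_le_dim(2)[OF assms(2)]) auto
    then show False using B i assms(4) \<open>x \<notin> insert e B\<close> by simp
  qed
  then show ?thesis using that B(4) span_breakdown_eq by metis
qed

lemma coord_functional:
  assumes "y \<noteq> 0"
  obtains f where "Vector_Spaces.linear scale (*) f" "f y = 1"
proof -
  interpret F: vector_space "(*) :: 'f \<Rightarrow> 'f \<Rightarrow> 'f" by unfold_locales (auto simp: algebra_simps)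
  interpret P: vector_space_pair scale "(*) :: 'f \<Rightarrow> 'f \<Rightarrow> 'f" ..
  show ?thesis using P.linear_independent_extend[of "{y}" "\<lambda>_. 1"] assms that by auto
qed

end

locale vect_pair = vs1: vect s1 + vs2: vect s2
  for s1 :: "'f::field \<Rightarrow> 'u::ab_group_add \<Rightarrow> 'u" and s2 :: "'f \<Rightarrow> 'v::ab_group_add \<Rightarrow> 'v"
begin

sublocale vector_space_pair s1 s2 ..

text \<open>
  A basis of the kernel together with preimages of a basis of the image is a basis of \<open>T\<close>. Only the
  kernel and the image are assumed to be finitely generated, so that the lemma can also be used to
  establish finite generation.
\<close>
lemma kernel_and_image:
  assumes f: "Vector_Spaces.linear s1 s2 f" and T: "vs1.subspace T"
    and K: "vs1.fin_gen {t \<in> T. f t = 0}" and I: "vs2.fin_gen (f ` T)"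
  shows fin_gen_of_kernel_image: "vs1.fin_gen T"
    and rank_nullity: "vs1.dim T = vs2.dim (f ` T) + vs1.dim {t \<in> T. f t = 0}"
proof -
  interpret f: Vector_Spaces.linear s1 s2 f by fact
  let ?K = "{t \<in> T. f t = 0}"
  have sK: "vs1.subspace ?K"
    using vs1.subspace_inter[OF T f.subspace_kernel] by (simp add: Int_def)
  obtain A where A: "finite A" "A \<subseteq> ?K" "vs1.independent A" "vs1.span A = ?K" "card A = vs1.dim ?K"
    using vs1.fin_gen_basis[OF sK K] by blast
  obtain D where D: "finite D" "D \<subseteq> f ` T" "vs2.independent D" "vs2.span D = f ` T" "card D = vs2.dim (f ` T)"
    using vs2.fin_gen_basis[OF f.subspace_image[OF T] I] by blast
  have "\<forall>d\<in>D. \<exists>t\<in>T. f t = d" using D(2) by auto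
  then obtain g where g: "\<And>d. d \<in> D \<Longrightarrow> g d \<in> T \<and> f (g d) = d" by metis
  have fg: "f ` g ` D = D" using g by force
  have inj: "inj_on g D" using g by (metis inj_onI)
  have sp: "x \<in> vs1.span (A \<union> g ` D)" if x: "x \<in> T" for x
  proof -
    have "f x \<in> f ` vs1.span (g ` D)"
      using x D(4) fg f.span_image[of "g ` D"] by (metis imageI)
    then obtain y where y: "y \<in> vs1.span (g ` D)" "f x = f y" by blast
    have "y \<in> T" using y(1) vs1.span_minimal[OF _ T, of "g ` D"] g by blast
    then have "x - y \<in> vs1.span A" using A(4) x y(2) vs1.subspace_diff[OF T] by (simp add: f.diff)
    then have "x - y + y \<in> vs1.span (A \<union> g ` D)"
      using y(1) by (intro vs1.span_add) (meson Un_upper1 Un_upper2 vs1.span_mono subsetD)+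
    then show ?thesis by simp
  qed
  show "vs1.fin_gen T"
    unfolding vs1.fin_gen_def by (rule exI[of _ "A \<union> g ` D"]) (use A D sp in auto)
  have dis: "A \<inter> g ` D = {}"
  proof (rule ccontr)
    assume "A \<inter> g ` D \<noteq> {}"
    then obtain d where "d \<in> D" "g d \<in> A" by blast
    then have "0 \<in> D" using g[of d] A(2) by auto
    then show False using D(3) vs2.dependent_zero by blast
  qed
  have ind: "vs1.independent (A \<union> g ` D)"
  proof (rule vs1.independent_if_scalars_zero)
    show "finite (A \<union> g ` D)" using A D by auto
    fix c x assume s: "(\<Sum>x\<in>A \<union> g ` D. s1 (c x) x) = 0" and x: "x \<in> A \<union> g ` D"
    have e: "(\<Sum>x\<in>A. s1 (c x) x) + (\<Sum>d\<in>D. s1 (c (g d)) (g d)) = 0"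
      using s A(1) D(1) dis by (simp add: sum.union_disjoint sum.reindex[OF inj])
    have a: "(\<Sum>x\<in>A. s1 (c x) x) \<in> ?K"
      unfolding A(4)[symmetric] by (intro vs1.span_sum vs1.span_scale vs1.span_base)
    have "f ((\<Sum>x\<in>A. s1 (c x) x) + (\<Sum>d\<in>D. s1 (c (g d)) (g d))) = 0" by (simp only: e f.zero)
    then have "f (\<Sum>d\<in>D. s1 (c (g d)) (g d)) = 0" using a by (simp add: f.add)
    then have "(\<Sum>d\<in>D. s2 (c (g d)) d) = 0" using g by (simp add: f.sum f.scale)
    then have cD: "c (g d) = 0" if "d \<in> D" for d
      using vs2.independentD[OF D(3,1) subset_refl _ that, of "\<lambda>d. c (g d)"] by simp
    then have "(\<Sum>x\<in>A. s1 (c x) x) = 0" using e by simp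
    then show "c x = 0"
      using x cD vs1.independentD[OF A(3,1) subset_refl, of c] by blast
  qed
  have "vs1.dim T = card (A \<union> g ` D)"
  proof (rule vs1.basis_card_eq_dim[symmetric])
    show "A \<union> g ` D \<subseteq> T" using A(2) g by auto
  qed (use ind sp in auto)
  also have "\<dots> = card A + card D"
    using card_Un_disjoint[OF A(1) _ dis] D(1) card_image[OF inj] by simp
  finally show "vs1.dim T = vs2.dim (f ` T) + vs1.dim ?K" using A(5) D(5) by simp
qed

lemma fin_gen_image:
  assumes "Vector_Spaces.linear s1 s2 f" "vs1.fin_gen T"
  shows "vs2.fin_gen (f ` T)"
  using assms(2) linear_spans_image[OF assms(1)] unfolding vs1.fin_gen_def vs2.fin_gen_def
  by (metis finite_imageI)

lemma dim_injective_image: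
  assumes f: "Vector_Spaces.linear s1 s2 f" and T: "vs1.subspace T" "vs1.fin_gen T"
    and inj: "\<And>t. t \<in> T \<Longrightarrow> f t = 0 \<Longrightarrow> t = 0"
  shows "vs2.dim (f ` T) = vs1.dim T"
proof -
  have "{t \<in> T. f t = 0} = {0}"
    using inj vs1.subspace_0[OF T(1)] linear_0[OF f] by auto
  moreover have "vs1.dim {0} = 0"
    using vs1.dim_unique[of "{}" "{0}" 0] vs1.span_empty by (auto simp: vs1.independent_empty)
  ultimately show ?thesis
    using rank_nullity[OF f T(1) vs1.fin_gen_mono[OF T(2)] fin_gen_image[OF f T(2)]]
      vs1.subspace_0[OF T(1)] by simp
qed

end

section \<open>Spaces of tuples\<close>

text \<open>
  Tuples indexed by \<open>J\<close> are functions that vanish outside \<open>J\<close>; without this normalisation the values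
  at other indices would contribute to dimensions.
\<close>
definition prod_space :: "'j set \<Rightarrow> ('j \<Rightarrow> 'v::zero set) \<Rightarrow> ('j \<Rightarrow> 'v) set"
  where "prod_space J H = {M. \<forall>j. M j \<in> (if j \<in> J then H j else {0})}"

lemma prod_spaceI: "(\<And>j. j \<in> J \<Longrightarrow> M j \<in> H j) \<Longrightarrow> (\<And>j. j \<notin> J \<Longrightarrow> M j = 0) \<Longrightarrow> M \<in> prod_space J H"
  by (simp add: prod_space_def)

lemma prod_spaceD:
  assumes "M \<in> prod_space J H"
  shows "j \<in> J \<Longrightarrow> M j \<in> H j" and "j \<notin> J \<Longrightarrow> M j = 0"
  using assms by (auto simp: prod_space_def dest: spec[of _ j])

lemma tuple_in:
  assumes "M \<in> T" "T \<subseteq> prod_space J (\<lambda>_. W)"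
  shows "j \<in> J \<Longrightarrow> M j \<in> W" and "j \<notin> J \<Longrightarrow> M j = 0"
  using prod_spaceD[of M J "\<lambda>_. W" j] assms by auto

lemma sum_fun_apply: "(\<Sum>x\<in>A. f x) i = (\<Sum>x\<in>A. f x i)" for f :: "'a \<Rightarrow> 'j \<Rightarrow> 'v::comm_monoid_add"
  by (induction A rule: infinite_finite_induct) auto

definition single :: "'j \<Rightarrow> 'v::zero \<Rightarrow> 'j \<Rightarrow> 'v"
  where "single j v = (\<lambda>i. if i = j then v else 0)"

lemma prod_space_sum_single:
  fixes M :: "'j \<Rightarrow> 'v::comm_monoid_add"
  assumes "finite J" "M \<in> prod_space J H"
  shows "M = (\<Sum>j\<in>J. single j (M j))"
proof
  fix i
  have "(\<Sum>j\<in>J. single j (M j)) i = (\<Sum>j\<in>J. if i = j then M j else 0)"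
    by (simp add: sum_fun_apply single_def)
  also have "\<dots> = M i" using assms(1) prod_spaceD(2)[OF assms(2)] by auto
  finally show "M i = (\<Sum>j\<in>J. single j (M j)) i" by simp
qed

text \<open>
  The dummy parameter fixes the index type. Without it, a sublocale declaration for the tuple spaces
  would apply to them again and iterate forever.
\<close>
locale tuples = vect scale for scale :: "'f::field \<Rightarrow> 'v::ab_group_add \<Rightarrow> 'v" +
  fixes index_type :: "'j itself"
begin

sublocale F: vect "fun_scale scale :: 'f \<Rightarrow> ('j \<Rightarrow> 'v) \<Rightarrow> 'j \<Rightarrow> 'v"
  unfolding vect_def by (rule vector_space_fun_scale) unfold_locales
sublocale FV: vect_pair "fun_scale scale :: 'f \<Rightarrow> ('j \<Rightarrow> 'v) \<Rightarrow> 'j \<Rightarrow> 'v" scale ..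
sublocale FF: vect_pair "fun_scale scale :: 'f \<Rightarrow> ('j \<Rightarrow> 'v) \<Rightarrow> 'j \<Rightarrow> 'v"
    "fun_scale scale :: 'f \<Rightarrow> ('j \<Rightarrow> 'v) \<Rightarrow> 'j \<Rightarrow> 'v" ..

lemma linear_eval: "Vector_Spaces.linear (fun_scale scale) scale (\<lambda>M :: 'j \<Rightarrow> 'v. M j)"
  unfolding Vector_Spaces.linear_iff
  by (auto simp: fun_scale_def F.vector_space_axioms vector_space_axioms)

lemma linear_post:
  assumes "Vector_Spaces.linear scale scale \<pi>"
  shows "Vector_Spaces.linear (fun_scale scale) (fun_scale scale) (\<lambda>(M :: 'j \<Rightarrow> 'v) j. \<pi> (M j))"
  using assms unfolding Vector_Spaces.linear_iff
  by (auto simp: fun_scale_def F.vector_space_axioms fun_eq_iff)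

lemma subspace_prod_space:
  assumes "\<And>j. j \<in> J \<Longrightarrow> subspace (H j)"
  shows "F.subspace (prod_space J H :: ('j \<Rightarrow> 'v) set)"
  using assms
  by (intro F.subspaceI)
     (auto simp: prod_space_def fun_scale_def subspace_0 subspace_add subspace_scale)

lemma subspace_slice:
  fixes T :: "('j \<Rightarrow> 'v) set"
  assumes "F.subspace T" "subspace Y"
  shows "F.subspace {t \<in> T. t j0 = 0 \<and> (\<forall>j. t j \<in> Y)}"
  using assms F.subspace_scale[OF assms(1), unfolded fun_scale_def]
  by (intro F.subspaceI)
     (auto simp: F.subspace_0 F.subspace_add subspace_0 subspace_add subspace_scale fun_scale_def)

text \<open>
  Induction on \<open>J\<close>: evaluation at a new index has image \<open>H j\<close> and kernel the product over the
  remaining indices.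
\<close>
lemma prod_space_dim:
  fixes H :: "'j \<Rightarrow> 'v set"
  assumes "finite J" "\<And>j. j \<in> J \<Longrightarrow> subspace (H j)" "\<And>j. j \<in> J \<Longrightarrow> fin_gen (H j)"
  shows fin_gen_prod_space: "F.fin_gen (prod_space J H)"
    and dim_prod_space: "F.dim (prod_space J H) = (\<Sum>j\<in>J. dim (H j))"
proof -
  have "F.fin_gen (prod_space J H) \<and> F.dim (prod_space J H) = (\<Sum>j\<in>J. dim (H j))"
    using assms
  proof (induction J)
    case empty
    have e: "prod_space {} H = {0}" by (auto simp: prod_space_def fun_eq_iff)
    have "F.dim {0} = 0" using F.dim_unique[of "{}" "{0}" 0] by (auto simp: F.independent_empty)
    then show ?case unfolding e F.fin_gen_def using F.span_superset[of "{0}"] by auto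
  next
    case (insert j J)
    let ?P = "prod_space (insert j J) H"
    have sub: "F.subspace ?P" using insert by (intro subspace_prod_space) auto
    have im: "(\<lambda>M. M j) ` ?P = H j"
    proof
      show "H j \<subseteq> (\<lambda>M. M j) ` ?P"
      proof
        fix v assume "v \<in> H j"
        then have "single j v \<in> ?P" using insert
          by (auto simp: prod_space_def single_def subspace_0)
        then show "v \<in> (\<lambda>M. M j) ` ?P" by (rule image_eqI[rotated]) (simp add: single_def)
      qed
    qed (auto dest: prod_spaceD(1))
    have ker: "{M \<in> ?P. M j = 0} = prod_space J H"
      using insert subspace_0 by (auto simp: prod_space_def split: if_splits)
    have IH: "F.fin_gen (prod_space J H)" "F.dim (prod_space J H) = (\<Sum>j\<in>J. dim (H j))"
      and Hj: "fin_gen (H j)" using insert by auto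
    note KI = linear_eval[of j] sub IH(1)[folded ker] Hj[folded im]
    have "F.fin_gen ?P" by (rule FV.fin_gen_of_kernel_image[OF KI])
    moreover have "F.dim ?P = dim (H j) + F.dim (prod_space J H)"
      using FV.rank_nullity[OF KI] unfolding im ker .
    ultimately show ?case using insert.hyps IH(2) by simp
  qed
  then show "F.fin_gen (prod_space J H)" "F.dim (prod_space J H) = (\<Sum>j\<in>J. dim (H j))" by auto
qed

end

section \<open>Deleting one column and one row\<close>

locale fin_tuples = tuples scale index_type
  for scale :: "'f::field \<Rightarrow> 'v::ab_group_add \<Rightarrow> 'v" and index_type :: "'j itself" +
  assumes fin: "fin_gen UNIV"
begin

lemma fin_gen: "fin_gen S"
  using fin_gen_mono[OF fin] by simp

lemma fin_gen_tuples:
  assumes "finite J" "T \<subseteq> prod_space J (\<lambda>_. W)" "subspace W"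
  shows "F.fin_gen (T :: ('j \<Rightarrow> 'v) set)"
  using F.fin_gen_mono[OF fin_gen_prod_space assms(2)] assms fin_gen by blast

lemma dim_span_single: "y \<noteq> 0 \<Longrightarrow> dim (span {y}) = 1"
  using dim_span_eq_card_independent[of "{y}"] by simp

text \<open>
  A tuple \<open>u\<close> over \<open>J\<close> with values in \<open>W\<close> is a matrix with columns \<open>u j\<close>, and it has full row rank
  iff its columns span \<open>W\<close>. Normalise the column \<open>j0\<close> of \<open>u\<close> to be \<open>y\<close> (possible since that column
  takes all values) and work modulo \<open>y\<close>, realising the quotient as the image \<open>W'\<close> of a projection
  along \<open>y\<close>. If the remaining columns spanned \<open>W'\<close>, then all columns would span \<open>W\<close>; so the smaller
  affine space still has no member of full rank. What the reduction forgets are the tuples in \<open>T\<close>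
  that vanish at \<open>j0\<close> and have all their values on the line of \<open>y\<close>.
\<close>
lemma column_reduction:
  fixes T :: "('j \<Rightarrow> 'v) set"
  assumes J: "finite J" "j0 \<in> J" and W: "subspace W"
    and T: "F.subspace T" "T \<subseteq> prod_space J (\<lambda>_. W)" and a: "a \<in> prod_space J (\<lambda>_. W)"
    and col: "(\<lambda>t. t j0) ` T = W"
    and nospan: "\<And>t. t \<in> T \<Longrightarrow> span ((a + t) ` J) \<noteq> W"
    and y: "y \<in> W" "y \<noteq> 0"
  obtains W' T' a' where "subspace W'" "dim W = dim W' + 1"
    "F.subspace T'" "T' \<subseteq> prod_space (J - {j0}) (\<lambda>_. W')" "a' \<in> prod_space (J - {j0}) (\<lambda>_. W')"
    "\<And>t. t \<in> T' \<Longrightarrow> span ((a' + t) ` (J - {j0})) \<noteq> W'"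
    "F.dim T = dim W + F.dim T' + F.dim {t \<in> T. t j0 = 0 \<and> (\<forall>j. t j \<in> span {y})}"
proof -
  interpret E: vect_pair scale scale ..
  obtain f where f: "Vector_Spaces.linear scale (*) f" "f y = 1" using coord_functional[OF y(2)] .
  \<comment> \<open>the projection along \<open>y\<close> onto the kernel of \<open>f\<close>\<close>
  define \<pi> where "\<pi> v = v - scale (f v) y" for v
  have lin: "Vector_Spaces.linear scale scale \<pi>"
    using f(1) unfolding Vector_Spaces.linear_iff \<pi>_def
    by (auto simp: vector_space_axioms scale_left_distrib scale_right_diff_distrib)
  interpret \<pi>: Vector_Spaces.linear scale scale \<pi> by fact
  have \<pi>0: "\<pi> v = 0 \<longleftrightarrow> v \<in> span {y}" for v
  proof
    assume "\<pi> v = 0"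
    then have "v = scale (f v) y" by (simp add: \<pi>_def)
    then show "v \<in> span {y}" by (metis span_base span_scale singletonI)
  next
    assume "v \<in> span {y}"
    then obtain k where "v = scale k y" unfolding span_singleton by auto
    moreover have "\<pi> y = 0" by (simp add: \<pi>_def f(2))
    ultimately show "\<pi> v = 0" by (simp add: \<pi>.scale)
  qed
  have yW: "span {y} \<subseteq> W" using y(1) W by (intro span_minimal) auto
  let ?W = "\<pi> ` W"
  have W': "subspace ?W" by (rule \<pi>.subspace_image[OF W])
  have "{w \<in> W. \<pi> w = 0} = span {y}" using yW \<pi>0 by auto
  then have dW: "dim W = dim ?W + 1"
    using E.rank_nullity[OF lin W] fin_gen dim_span_single[OF y(2)] by simp
  define K where "K = {t \<in> T. t j0 = 0}"
  have K: "F.subspace K"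
    using F.subspace_inter[OF T(1) FV.linear_subspace_kernel[OF linear_eval[of j0]]]
    by (simp add: K_def Int_def)
  have fT: "F.fin_gen S" if "S \<subseteq> T" for S
    by (rule fin_gen_tuples[OF J(1) _ W]) (use that T(2) in blast)
  have d1: "F.dim T = dim W + F.dim K"
    using FV.rank_nullity[OF linear_eval[of j0] T(1)] fT fin_gen unfolding K_def col by auto
  define g :: "('j \<Rightarrow> 'v) \<Rightarrow> 'j \<Rightarrow> 'v" where "g M = (\<lambda>j. \<pi> (M j))" for M
  have lg: "Vector_Spaces.linear (fun_scale scale) (fun_scale scale) g"
    unfolding g_def by (rule linear_post[OF lin])
  have "{t \<in> K. g t = 0} = {t \<in> T. t j0 = 0 \<and> (\<forall>j. t j \<in> span {y})}"
    using \<pi>0 by (auto simp: K_def g_def fun_eq_iff)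
  then have d2: "F.dim K = F.dim (g ` K) + F.dim {t \<in> T. t j0 = 0 \<and> (\<forall>j. t j \<in> span {y})}"
    using FF.rank_nullity[OF lg K] fT FF.fin_gen_image[OF lg fT, of K] by (auto simp: K_def)
  have "y - a j0 \<in> W" using y(1) prod_spaceD(1)[OF a J(2)] by (intro subspace_diff[OF W])
  then obtain t0 where t0: "t0 \<in> T" "t0 j0 = y - a j0" using col by (metis imageE)
  \<comment> \<open>the base point is moved so that its column \<open>j0\<close> is \<open>y\<close>; then \<open>K\<close> is the set of admissible translations\<close>
  define b where "b = a + t0"
  have b: "b j0 = y" by (simp add: b_def t0)
  have bP: "b \<in> prod_space J (\<lambda>_. W)"
    unfolding b_def using a t0(1) T(2) W by (intro F.subspace_add subspace_prod_space) auto
  have gP: "g M \<in> prod_space (J - {j0}) (\<lambda>_. ?W)" if "M \<in> prod_space J (\<lambda>_. W)" "M j0 \<in> span {y}" for M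
    using that(2) \<pi>0[of "M j0"] prod_spaceD[OF that(1)]
    by (intro prod_spaceI) (auto simp: g_def \<pi>.zero)
  show ?thesis
  proof (rule that[OF W' dW FF.linear_subspace_image[OF lg K]])
    show "g ` K \<subseteq> prod_space (J - {j0}) (\<lambda>_. ?W)"
      using gP T(2) span_zero by (auto simp: K_def)
    show "g b \<in> prod_space (J - {j0}) (\<lambda>_. ?W)"
      using gP[OF bP] b span_base by simp
    show "F.dim T = dim W + F.dim (g ` K) + F.dim {t \<in> T. t j0 = 0 \<and> (\<forall>j. t j \<in> span {y})}"
      using d1 d2 by simp
    fix s assume "s \<in> g ` K"
    then obtain k where k: "k \<in> K" "s = g k" by blast
    define u where "u = b + k"
    have uP: "u j \<in> W" if "j \<in> J" for j
    proof -
      have "u \<in> prod_space J (\<lambda>_. W)" unfolding u_def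
        using bP k(1) T(2) W by (intro F.subspace_add subspace_prod_space) (auto simp: K_def)
      then show ?thesis using prod_spaceD(1) that by fast
    qed
    have uy: "u j0 = y" using k(1) b by (simp add: u_def K_def)
    have u': "u = a + (t0 + k)" by (simp add: u_def b_def add.assoc)
    have "t0 + k \<in> T" using t0(1) k(1) F.subspace_add[OF T(1)] by (simp add: K_def)
    then have ns: "span (u ` J) \<noteq> W" unfolding u' by (rule nospan)
    show "span ((g b + s) ` (J - {j0})) \<noteq> ?W"
    proof
      assume eq: "span ((g b + s) ` (J - {j0})) = ?W"
      have "(g b + s) ` (J - {j0}) = \<pi> ` u ` (J - {j0})"
        unfolding image_image by (rule image_cong) (auto simp: k(2) g_def u_def \<pi>.add)
      then have im: "?W = \<pi> ` span (u ` (J - {j0}))" using eq \<pi>.span_image by simp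
      have "W \<subseteq> span (u ` J)"
      proof
        fix w assume "w \<in> W"
        then obtain v where v: "v \<in> span (u ` (J - {j0}))" "\<pi> w = \<pi> v" using im by blast
        then have "w - v \<in> span {y}" using \<pi>0[of "w - v"] by (simp add: \<pi>.diff)
        moreover have "span {y} \<subseteq> span (u ` J)" using uy J(2) by (intro span_mono) auto
        moreover have "v \<in> span (u ` J)" using v(1) span_mono[of "u ` (J - {j0})" "u ` J"] by blast
        ultimately have "w - v + v \<in> span (u ` J)" by (intro span_add) auto
        then show "w \<in> span (u ` J)" by simp
      qed
      moreover have "span (u ` J) \<subseteq> W" using uP W by (intro span_minimal) auto
      ultimately show False using ns by blast
    qed
  qed
qed

end

section \<open>The dimension bound\<close>

context fin_tuples
begin

lemma spanning_tuple:
  assumes "finite J" "subspace W" "dim W \<le> card J"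
  obtains M :: "'j \<Rightarrow> 'v" where "M \<in> prod_space J (\<lambda>_. W)" "span (M ` J) = W"
proof -
  obtain B where B: "finite B" "B \<subseteq> W" "independent B" "span B = W" "card B = dim W"
    using fin_gen_basis[OF assms(2) fin_gen] .
  obtain g where g: "g ` B \<subseteq> J" "inj_on g B"
    using card_le_inj[OF B(1) assms(1)] B(5) assms(3) by auto
  define M where "M j = (if j \<in> g ` B then inv_into B g j else 0)" for j
  have MB: "M (g b) = b" if "b \<in> B" for b using that g(2) by (simp add: M_def)
  have MW: "M j \<in> W" for j
    using B(2) subspace_0[OF assms(2)] inv_into_into[of j g B] by (auto simp: M_def)
  show ?thesis
  proof
    show "M \<in> prod_space J (\<lambda>_. W)" using MW g(1) by (intro prod_spaceI) (auto simp: M_def)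
    have "b \<in> M ` J" if "b \<in> B" for b
      using MB[OF that] g(1) that by (intro image_eqI[of _ _ "g b"]) auto
    then have "span B \<subseteq> span (M ` J)" by (intro span_mono) auto
    moreover have "span (M ` J) \<subseteq> W" using MW assms(2) by (intro span_minimal) auto
    ultimately show "span (M ` J) = W" using B(4) by auto
  qed
qed

lemma dim_prod_const: "finite J \<Longrightarrow> subspace W \<Longrightarrow> F.dim (prod_space J (\<lambda>_. W) :: ('j \<Rightarrow> 'v) set) = card J * dim W"
  using dim_prod_space[of J "\<lambda>_. W"] fin_gen by simp

text \<open>
  Induction on \<open>dim W\<close>. If \<open>T\<close> had codimension less than \<open>card J\<close>, then some column would take all
  values in \<open>W\<close>: otherwise each column costs at least one dimension. Reducing along this column
  and a nonzero \<open>y\<close>, the induction hypothesis leaves so few dimensions for the reduced space that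
  the forgotten slice must contain every tuple on the line of \<open>y\<close> that vanishes at \<open>j0\<close>. As \<open>y\<close> is
  arbitrary, \<open>T\<close> contains all tuples and the affine space has a spanning member.

  The additive form stays strong for \<open>dim W = 0\<close>, where no affine space satisfies the hypotheses; the
  step to \<open>dim W = 1\<close> relies on this.
\<close>
lemma codim_bound:
  fixes T :: "('j \<Rightarrow> 'v) set"
  assumes "finite J" "subspace W" "dim W \<le> card J"
    "F.subspace T" "T \<subseteq> prod_space J (\<lambda>_. W)" "a \<in> prod_space J (\<lambda>_. W)"
    "\<And>t. t \<in> T \<Longrightarrow> span ((a + t) ` J) \<noteq> W"
  shows "F.dim T + card J \<le> card J * dim W"
  using assms
proof (induction "dim W" arbitrary: J W T a)
  case 0
  obtain B where "finite B" "span B = W" "card B = dim W"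
    using fin_gen_basis[OF "0.prems"(2) fin_gen] .
  then have W: "W = {0}" using 0(1) by auto
  have "(a + 0) ` J \<subseteq> {0}" using prod_spaceD(1)[OF "0.prems"(6)] W by auto
  then have "span ((a + 0) ` J) \<subseteq> {0}" using span_minimal subspace_single_0 by blast
  then have "span ((a + 0) ` J) = W" using W span_zero by blast
  then show ?case using "0.prems"(7)[of 0] F.subspace_0[OF "0.prems"(4)] by blast
next
  case (Suc m)
  note J = \<open>finite J\<close> and W = \<open>subspace W\<close> and T = \<open>F.subspace T\<close> \<open>T \<subseteq> prod_space J (\<lambda>_. W)\<close>
    and a = \<open>a \<in> prod_space J (\<lambda>_. W)\<close> and ns = Suc.prems(7)
  have n: "dim W = Suc m" using Suc(2) by simp
  show ?case
  proof (rule ccontr)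
    assume "\<not> ?thesis"
    then have big: "card J * m < F.dim T" using n by simp
    have "\<exists>j0\<in>J. (\<lambda>t. t j0) ` T = W"
    proof (rule ccontr)
      assume no: "\<not> ?thesis"
      define H where "H j = (\<lambda>t. t j) ` T" for j
      have H: "subspace (H j)" for j
        unfolding H_def by (rule FV.linear_subspace_image[OF linear_eval T(1)])
      have HW: "H j \<subseteq> W" if "j \<in> J" for j
        using tuple_in(1)[OF _ T(2) that] by (auto simp: H_def)
      have "dim (H j) \<le> m" if "j \<in> J" for j
      proof (rule ccontr)
        assume "\<not> dim (H j) \<le> m"
        then have "H j = W" using subspace_eq_of_dim_le[OF H fin_gen HW[OF that]] n by simp
        then show False using no that by (auto simp: H_def)
      qed
      then have "(\<Sum>j\<in>J. dim (H j)) \<le> card J * m" using sum_bounded_above[of J "\<lambda>j. dim (H j)" m] by simp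
      moreover have "T \<subseteq> prod_space J H"
        using tuple_in(2)[OF _ T(2)] by (auto intro!: prod_spaceI simp: H_def)
      then have "F.dim T \<le> F.dim (prod_space J H)"
        using F.dim_mono_fin_gen fin_gen_prod_space[OF J] H fin_gen by blast
      ultimately show False using dim_prod_space[OF J, of H] H fin_gen big by simp
    qed
    then obtain j0 where j0: "j0 \<in> J" and col: "(\<lambda>t. t j0) ` T = W" by blast
    let ?J = "J - {j0}"
    have cJ: "card J = Suc (card ?J)" using J j0 by (metis card_Suc_Diff1)
    have single_in: "single j y \<in> T" if j: "j \<in> ?J" and y: "y \<in> W" for j y
    proof (cases "y = 0")
      case True
      then have "single j y = 0" by (auto simp: single_def)
      then show ?thesis using F.subspace_0[OF T(1)] by simp
    next
      case False
      obtain W' T' a' where *: "subspace W'" "dim W = dim W' + 1"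
        "F.subspace T'" "T' \<subseteq> prod_space ?J (\<lambda>_. W')" "a' \<in> prod_space ?J (\<lambda>_. W')"
        "\<And>t. t \<in> T' \<Longrightarrow> span ((a' + t) ` ?J) \<noteq> W'"
        "F.dim T = dim W + F.dim T' + F.dim {t \<in> T. t j0 = 0 \<and> (\<forall>j. t j \<in> span {y})}"
        by (rule column_reduction[OF J j0 W T a col ns y False]) (assumption, rule that)
      let ?K = "{t \<in> T. t j0 = 0 \<and> (\<forall>j. t j \<in> span {y})}"
      have m: "m = dim W'" using *(2) n by simp
      have "dim W' \<le> card ?J" using Suc.prems(3) n m cJ by simp
      then have "F.dim T' + card ?J \<le> card ?J * m"
        unfolding m using J by (intro Suc(1)[OF m _ *(1) _ *(3,4,5)] *(6)) auto
      then have dK: "card ?J \<le> F.dim ?K" using big *(7) n cJ by simp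
      have sub: "F.subspace ?K"
        by (rule subspace_slice[OF T(1) subspace_span])
      have "?K \<subseteq> prod_space ?J (\<lambda>_. span {y})"
        using tuple_in(2)[OF _ T(2)] by (auto intro!: prod_spaceI)
      then have "?K = prod_space ?J (\<lambda>_. span {y})"
        using dK dim_prod_const[of ?J "span {y}"] dim_span_single[OF False] J
        by (intro F.subspace_eq_of_dim_le[OF sub]) (auto intro: fin_gen_tuples)
      moreover have "single j y \<in> prod_space ?J (\<lambda>_. span {y})"
        using j by (auto intro!: prod_spaceI simp: single_def span_base span_zero split: if_splits)
      ultimately show ?thesis by blast
    qed
    have "M \<in> T" if M: "M \<in> prod_space J (\<lambda>_. W)" for M
    proof -
      have "M j0 \<in> W" using prod_spaceD(1)[OF M j0] .
      then obtain t where t: "t \<in> T" "t j0 = M j0" using col by (metis imageE)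
      have "M - t \<in> prod_space J (\<lambda>_. W)"
        using M t(1) T(2) W by (intro F.subspace_diff subspace_prod_space) auto
      then have "M - t \<in> prod_space ?J (\<lambda>_. W)"
        using t(2) tuple_in[OF _ subset_refl, of "M - t"] by (intro prod_spaceI) auto
      note P = this
      have eq: "M - t = (\<Sum>j\<in>?J. single j ((M - t) j))"
        by (rule prod_space_sum_single[OF _ P]) (use J in simp)
      have W': "(M - t) j \<in> W" if "j \<in> ?J" for j
        by (rule tuple_in(1)[OF P subset_refl that])
      have "M - t \<in> T"
        by (subst eq, rule F.subspace_sum[OF T(1)], rule single_in) (use W' in auto)
      then have "M - t + t \<in> T" using t(1) F.subspace_add[OF T(1)] by blast
      then show ?thesis by simp
    qed
    moreover obtain M where M: "M \<in> prod_space J (\<lambda>_. W)" "span (M ` J) = W"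
      using spanning_tuple[OF J W Suc.prems(3)] .
    ultimately have "M - a \<in> T"
      using a W by (metis F.subspace_diff subspace_prod_space)
    then show False using ns[of "M - a"] M(2) by simp
  qed
qed


end

section \<open>Affine maps that send every vector to its own line\<close>

context vect
begin

lemma pair_independent:
  assumes "w \<notin> span {v}" "scale \<alpha> v = scale \<beta> w"
  shows "\<beta> = 0"
proof (rule ccontr)
  assume "\<beta> \<noteq> 0"
  then have "w = scale (inverse \<beta> * \<alpha>) v" using assms(2) by (metis scale_scale left_inverse scale_one)
  then show False using assms(1) by (simp add: span_base span_scale)
qed

lemma span_single_sym: "v \<in> span {a} \<Longrightarrow> v \<noteq> 0 \<Longrightarrow> a \<in> span {v}"
  using in_span_insert[of v a "{}"] by auto

text \<open>
  If \<open>v0 = 0\<close>, every nonzero vector is an eigenvector of \<open>\<beta>\<close>, hence \<open>\<beta>\<close> is a scalar. If \<open>v0 \<noteq> 0\<close>,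
  the hypothesis is compared at \<open>a\<close> and \<open>k a\<close>, for \<open>a\<close> not on the line of \<open>v0\<close>: the multiples of
  \<open>v0\<close> differ by the factor \<open>1 - k\<close>, which must vanish for all \<open>k \<noteq> 0\<close>. Likewise, comparing at \<open>a\<close>,
  \<open>b\<close> and \<open>a + b\<close> gives a linear relation among \<open>v0\<close>, \<open>a\<close> and \<open>b\<close> with coefficient \<open>1\<close> at \<open>v0\<close>; so
  no \<open>b\<close> lies outside the plane of \<open>v0\<close> and \<open>a\<close>.
\<close>
lemma scalar_or_two_elements:
  assumes fin: "fin_gen UNIV" and n: "2 \<le> dim UNIV"
    and lin: "Vector_Spaces.linear scale scale \<beta>"
    and ev: "\<And>w. w \<noteq> 0 \<Longrightarrow> v0 + \<beta> w \<in> span {w}"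
  shows "(v0 = 0 \<and> (\<exists>c. \<forall>w. \<beta> w = scale c w)) \<or>
    (v0 \<noteq> 0 \<and> dim UNIV = 2 \<and> card (UNIV :: 'f set) = 2)"
proof -
  interpret \<beta>: Vector_Spaces.linear scale scale \<beta> by fact
  have ex: "\<exists>x. x \<notin> span G" if "finite G" "card G < dim UNIV" for G
    using dim_le_card[OF _ that(1), of UNIV] that(2) by fastforce
  have ev': "\<exists>c. v0 + \<beta> w = scale c w" if "w \<noteq> 0" for w
    using ev[OF that] by (auto simp: span_singleton)
  show ?thesis
  proof (cases "v0 = 0")
    case True
    obtain w0 where "w0 \<notin> span {}" using ex[of "{}"] n by auto
    then have w0: "w0 \<noteq> 0" by simp
    obtain c where c: "\<beta> w0 = scale c w0" using ev'[OF w0] True by auto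
    have "\<beta> w = scale c w" for w
    proof (cases "w \<in> span {w0}")
      case True
      then obtain k where "w = scale k w0" by (auto simp: span_singleton)
      then show ?thesis using c by (simp add: \<beta>.scale mult.commute)
    next
      case False
      then have "w \<noteq> 0" "w0 + w \<noteq> 0"
        using span_zero span_neg[OF span_base[of w0 "{w0}"]] by (auto simp: add_eq_0_iff)
      then obtain d e where d: "\<beta> w = scale d w" and e: "\<beta> (w0 + w) = scale e (w0 + w)"
        using ev' \<open>v0 = 0\<close> by fastforce
      have eq: "scale (e - c) w0 = scale (d - e) w"
        using e by (simp add: \<beta>.add c d scale_left_diff_distrib scale_right_distrib algebra_simps)
      then have "d = e" using pair_independent[OF False eq] by simp
      then have "e = c" using eq w0 by simp
      then show ?thesis using d \<open>d = e\<close> by simp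
    qed
    then show ?thesis using True by blast
  next
    case v0: False
    obtain a where a: "a \<notin> span {v0}" using ex[of "{v0}"] n by auto
    then have a0: "a \<noteq> 0" using span_zero by auto
    have va: "v0 \<notin> span {a}" using a span_single_sym v0 by blast
    obtain c where c: "v0 + \<beta> a = scale c a" using ev'[OF a0] by blast
    have "k = 1" if k: "k \<noteq> 0" for k :: 'f
    proof -
      obtain d where d: "v0 + \<beta> (scale k a) = scale d (scale k a)" 
        using ev'[of "scale k a"] k a0 by auto
      have "\<beta> a = scale c a - v0" using c by (simp add: algebra_simps)
      then have "v0 + scale k (scale c a - v0) = scale (d * k) a"
        using d by (simp add: \<beta>.scale)
      then have "scale (d * k - k * c) a = scale (1 - k) v0"
        by (simp add: scale_left_diff_distrib scale_right_diff_distrib algebra_simps)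
      then show ?thesis using pair_independent[OF va] by fastforce
    qed
    then have "(UNIV :: 'f set) = {0, 1}" by auto
    then have F2: "card (UNIV :: 'f set) = 2" by (metis card_2_iff zero_neq_one)
    have "\<not> 2 < dim UNIV"
    proof
      assume "2 < dim UNIV"
      moreover have "card {v0, a} \<le> 2" by (simp add: card_insert_if)
      ultimately obtain b where b: "b \<notin> span {v0, a}" using ex[of "{v0, a}"] by auto
      have "- a \<in> span {v0, a}" by (simp add: span_neg span_base)
      then have "b \<noteq> 0" "a + b \<noteq> 0" using b span_zero by (auto simp: add_eq_0_iff)
      then obtain d e where d: "v0 + \<beta> b = scale d b" and e: "v0 + \<beta> (a + b) = scale e (a + b)"
        using ev' by metis
      have "scale c a + scale d b = v0 + scale e (a + b)"
        unfolding c[symmetric] d[symmetric] e[symmetric] \<beta>.add by (simp add: algebra_simps)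
      then have eq: "scale (d - e) b = scale (e - c) a + v0"
        by (simp add: scale_left_diff_distrib scale_right_distrib algebra_simps)
      have "d = e"
      proof (rule ccontr)
        assume "d \<noteq> e"
        then have "b = scale (inverse (d - e)) (scale (e - c) a + v0)" by (simp add: eq[symmetric])
        moreover have "\<dots> \<in> span {v0, a}" by (intro span_scale span_add) (auto simp: span_base span_scale)
        ultimately show False using b by simp
      qed
      then have "v0 = scale (c - e) a" using eq by (simp add: scale_left_diff_distrib algebra_simps add_eq_0_iff)
      then show False using va by (simp add: span_base span_scale)
    qed
    then show ?thesis using n v0 F2 by auto
  qed
qed

end

section \<open>Extremal spaces with an onto column\<close>

lemma field_vect: "vect ((*) :: 'f::field \<Rightarrow> 'f \<Rightarrow> 'f)" "vect.fin_gen ((*) :: 'f \<Rightarrow> 'f \<Rightarrow> 'f) UNIV"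
  "vector_space.dim ((*) :: 'f \<Rightarrow> 'f \<Rightarrow> 'f) UNIV = 1"
proof -
  show v: "vect ((*) :: 'f \<Rightarrow> 'f \<Rightarrow> 'f)" by unfold_locales (auto simp: algebra_simps)
  interpret vect "(*) :: 'f \<Rightarrow> 'f \<Rightarrow> 'f" by (rule v)
  have u: "span {1} = (UNIV :: 'f set)" by (auto simp: span_singleton)
  then show "fin_gen UNIV" unfolding fin_gen_def by (metis finite.emptyI finite_insert order_refl)
  have "dim (span {1 :: 'f}) = card {1 :: 'f}" by (rule dim_span_eq_card_independent) simp
  then show "dim UNIV = 1" by (simp add: u)
qed

context fin_tuples
begin

text \<open>
  With \<open>p = q + 1\<close> columns and \<open>n = m + 1\<close> rows, the hypothesis on \<open>dim T\<close> says that the codimension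
  is at most \<open>p\<close>. The bound for the reduced space then shows that \<open>T\<close> contains, for each nonzero \<open>y\<close>, at
  least a hyperplane of the tuples on the line of \<open>y\<close> that vanish at \<open>j0\<close>.
\<close>
lemma slice_dim_ge:
  fixes T :: "('j \<Rightarrow> 'v) set"
  assumes J: "finite J" "j0 \<in> J" "card J = Suc q" and n: "dim UNIV = Suc m" "m \<le> q"
    and T: "F.subspace T" "T \<subseteq> prod_space J (\<lambda>_. UNIV)" "a \<in> prod_space J (\<lambda>_. UNIV)"
    and col: "(\<lambda>t. t j0) ` T = UNIV"
    and nospan: "\<And>t. t \<in> T \<Longrightarrow> span ((a + t) ` J) \<noteq> UNIV"
    and dT: "Suc q * m \<le> F.dim T" and y: "y \<noteq> 0"
  shows "q \<le> F.dim {t \<in> T. t j0 = 0 \<and> (\<forall>j. t j \<in> span {y})} + 1"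
proof -
  let ?J = "J - {j0}"
  obtain W' T' a' where *: "subspace W'" "dim UNIV = dim W' + 1"
    "F.subspace T'" "T' \<subseteq> prod_space ?J (\<lambda>_. W')" "a' \<in> prod_space ?J (\<lambda>_. W')"
    "\<And>t. t \<in> T' \<Longrightarrow> span ((a' + t) ` ?J) \<noteq> W'"
    "F.dim T = dim UNIV + F.dim T' + F.dim {t \<in> T. t j0 = 0 \<and> (\<forall>j. t j \<in> span {y})}"
    by (rule column_reduction[OF J(1,2) subspace_UNIV T col nospan UNIV_I y]) (assumption, rule that)
  have cJ: "card ?J = q" using J by simp
  have m: "dim W' = m" using *(2) n(1) by simp
  have "F.dim T' + card ?J \<le> card ?J * dim W'"
    using J n(2) m cJ by (intro codim_bound[OF _ *(1) _ *(3,4,5)] *(6)) auto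
  then show ?thesis using *(7) n dT cJ m by simp
qed

text \<open>
  For \<open>v\<close> in \<open>V\<close> let \<open>C v\<close> be the space of scalar tuples \<open>c\<close> over \<open>J - {j0}\<close> with \<open>c \<otimes> v \<in> T\<close>; for
  \<open>v \<noteq> 0\<close> it has codimension at most one. Over a basis \<open>Y\<close> of \<open>V\<close> the \<open>C y \<otimes> y\<close> form a direct sum
  inside \<open>K = {t \<in> T. t j0 = 0}\<close>, which has codimension \<open>card J\<close> among the tuples over \<open>J - {j0}\<close>.
  Since at most \<open>dim V \<le> card J\<close> dimensions are lost, \<open>card J = dim V\<close>, the sum is all of \<open>K\<close>, and
  every \<open>C y\<close> is a hyperplane. Directness gives \<open>C (y1 + y2) \<subseteq> C y1 \<inter> C y2\<close> for distinct basis
  vectors; comparing dimensions, all \<open>C y\<close> are one and the same hyperplane \<open>D\<close>. An equation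
  \<open>\<Sum>j. z j * c j = 0\<close> of \<open>D\<close> then describes \<open>K\<close> as well.
\<close>
lemma kernel_is_functional:
  fixes T :: "('j \<Rightarrow> 'v) set"
  assumes J: "finite J" "j0 \<in> J" "dim UNIV \<le> card J"
    and T: "F.subspace T" "T \<subseteq> prod_space J (\<lambda>_. UNIV)" "a \<in> prod_space J (\<lambda>_. UNIV)"
    and col: "(\<lambda>t. t j0) ` T = UNIV"
    and nospan: "\<And>t. t \<in> T \<Longrightarrow> span ((a + t) ` J) \<noteq> UNIV"
    and dT: "F.dim T + card J = card J * dim UNIV"
  obtains z j1 where "card J = dim UNIV" "j1 \<in> J - {j0}" "z j1 = 1"
    "\<And>t. t \<in> prod_space J (\<lambda>_. UNIV) \<Longrightarrow> t j0 = 0 \<Longrightarrow>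
      t \<in> T \<longleftrightarrow> (\<Sum>j\<in>J - {j0}. scale (z j) (t j)) = 0"
proof -
  interpret S: fin_tuples "(*) :: 'f \<Rightarrow> 'f \<Rightarrow> 'f" "TYPE('j)"
    using field_vect by (intro fin_tuples.intro fin_tuples_axioms.intro tuples.intro)
  interpret Q: tuples "fun_scale (*) :: 'f \<Rightarrow> ('j \<Rightarrow> 'f) \<Rightarrow> 'j \<Rightarrow> 'f" "TYPE('v)" ..
  interpret SF: vect_pair "fun_scale (*) :: 'f \<Rightarrow> ('j \<Rightarrow> 'f) \<Rightarrow> 'j \<Rightarrow> 'f"
    "fun_scale scale :: 'f \<Rightarrow> ('j \<Rightarrow> 'v) \<Rightarrow> 'j \<Rightarrow> 'v" ..
  interpret QF: vect_pair "fun_scale (fun_scale (*)) :: 'f \<Rightarrow> ('v \<Rightarrow> 'j \<Rightarrow> 'f) \<Rightarrow> 'v \<Rightarrow> 'j \<Rightarrow> 'f"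
    "fun_scale scale :: 'f \<Rightarrow> ('j \<Rightarrow> 'v) \<Rightarrow> 'j \<Rightarrow> 'v" ..
  let ?J = "J - {j0}"
  let ?E = "prod_space ?J (\<lambda>_. UNIV) :: ('j \<Rightarrow> 'f) set"
  obtain q where q: "card J = Suc q" using J(1,2) by (metis card_Suc_Diff1)
  have cJ: "card ?J = q" using J q by simp
  have "dim UNIV \<noteq> 0" using dT q by (cases "dim UNIV") auto
  then obtain m where m: "dim UNIV = Suc m" by (metis not0_implies_Suc)
  have mq: "m \<le> q" using J(3) q m by simp
  have dT': "F.dim T = Suc q * m" using dT q m by simp
  have fT: "F.fin_gen S" if "S \<subseteq> T" for S
    by (rule fin_gen_tuples[OF J(1) _ subspace_UNIV]) (use that T(2) in blast)
  define K where "K = {t \<in> T. t j0 = 0}"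
  have K: "F.subspace K"
    using F.subspace_inter[OF T(1) FV.linear_subspace_kernel[OF linear_eval[of j0]]]
    by (simp add: K_def Int_def)
  have KT: "K \<subseteq> T" by (auto simp: K_def)
  have "F.dim T = dim UNIV + F.dim K"
    using FV.rank_nullity[OF linear_eval[of j0] T(1)] fT fin_gen unfolding K_def col by auto
  then have dK: "F.dim K + 1 = q * m" using dT' m by simp

  define tensor :: "('j \<Rightarrow> 'f) \<Rightarrow> 'v \<Rightarrow> 'j \<Rightarrow> 'v" where "tensor c v = (\<lambda>j. scale (c j) v)" for c v
  have lin_tensor: "Vector_Spaces.linear (fun_scale (*)) (fun_scale scale) (\<lambda>c. tensor c v)" for v
    unfolding Vector_Spaces.linear_iff
    by (auto simp: tensor_def fun_scale_def fun_eq_iff scale_left_distrib S.F.vector_space_axioms F.vector_space_axioms)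
  have lin_tensor2: "Vector_Spaces.linear scale (fun_scale scale) (tensor c)" for c
    unfolding Vector_Spaces.linear_iff
    by (auto simp: tensor_def fun_scale_def fun_eq_iff scale_right_distrib mult.commute vector_space_axioms F.vector_space_axioms)
  define C where "C v = {c \<in> ?E. tensor c v \<in> T}" for v
  have subC: "S.F.subspace (C v)" for v
    using S.F.subspace_inter[OF S.subspace_prod_space[of ?J "\<lambda>_. UNIV"] SF.linear_subspace_linear_preimage[OF lin_tensor T(1)], of v]
    by (simp add: C_def Int_def)
  have CE: "C v \<subseteq> ?E" for v by (auto simp: C_def)
  have fC: "S.F.fin_gen S" if "S \<subseteq> ?E" for S
    using S.fin_gen_tuples[OF _ that S.subspace_UNIV] J(1) by simp
  have dE: "S.F.dim ?E = q"
    using S.dim_prod_const[of ?J UNIV] J(1) cJ field_vect(3)[where 'f = 'f] by simp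
  have dC: "q \<le> S.F.dim (C v) + 1" if v: "v \<noteq> 0" for v
  proof -
    have "(\<lambda>c. tensor c v) ` C v = {t \<in> T. t j0 = 0 \<and> (\<forall>j. t j \<in> span {v})}"
    proof (intro set_eqI iffI)
      fix t assume "t \<in> (\<lambda>c. tensor c v) ` C v"
      then obtain c where c: "c \<in> ?E" "tensor c v \<in> T" "t = tensor c v" by (auto simp: C_def)
      have "c j0 = 0" using tuple_in(2)[OF c(1) subset_refl] by simp
      then show "t \<in> {t \<in> T. t j0 = 0 \<and> (\<forall>j. t j \<in> span {v})}"
        using c by (auto simp: tensor_def span_base span_scale)
    next
      fix t assume t: "t \<in> {t \<in> T. t j0 = 0 \<and> (\<forall>j. t j \<in> span {v})}"
      then have "\<forall>j. \<exists>k. t j = scale k v" by (auto simp: span_singleton)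
      then obtain c where c: "\<And>j. t j = scale (c j) v" by metis
      have "c j = 0" if "j \<notin> ?J" for j
      proof -
        have "t j = 0" using t tuple_in(2)[OF _ T(2), of t j] that by (cases "j = j0") auto
        then show ?thesis using c[of j] v by simp
      qed
      then have "c \<in> ?E" by (intro prod_spaceI) auto
      moreover have "t = tensor c v" using c by (auto simp: tensor_def)
      ultimately show "t \<in> (\<lambda>c. tensor c v) ` C v" using t by (auto simp: C_def)
    qed
    moreover have "F.dim ((\<lambda>c. tensor c v) ` C v) = S.F.dim (C v)"
      using v by (intro SF.dim_injective_image[OF lin_tensor subC fC[OF CE]]) (auto simp: tensor_def fun_eq_iff)
    ultimately show ?thesis
      using slice_dim_ge[OF J(1,2) q m mq T col nospan _ v] dT' by simp
  qed

  obtain Y where Y: "finite Y" "independent Y" "span Y = UNIV" "card Y = dim UNIV"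
    using fin_gen_basis[OF subspace_UNIV fin] by metis
  have Y0: "y \<noteq> 0" if "y \<in> Y" for y using Y(2) that dependent_zero by blast
  \<comment> \<open>tuples of vectors are families, indexed by \<open>Y\<close>, of scalar tuples: their coordinates\<close>
  define \<Psi> :: "('v \<Rightarrow> 'j \<Rightarrow> 'f) \<Rightarrow> 'j \<Rightarrow> 'v" where "\<Psi> \<gamma> = (\<Sum>y\<in>Y. tensor (\<gamma> y) y)" for \<gamma>
  have \<Psi>_apply: "\<Psi> \<gamma> j = (\<Sum>y\<in>Y. scale (\<gamma> y j) y)" for \<gamma> j
    by (simp add: \<Psi>_def tensor_def sum_fun_apply)
  have lin\<Psi>: "Vector_Spaces.linear (fun_scale (fun_scale (*))) (fun_scale scale) \<Psi>"
    unfolding Vector_Spaces.linear_iff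
    by (auto simp: \<Psi>_apply fun_scale_def fun_eq_iff scale_left_distrib sum.distrib scale_sum_right
        Q.F.vector_space_axioms F.vector_space_axioms)
  let ?Q = "prod_space Y (\<lambda>_. UNIV) :: ('v \<Rightarrow> 'j \<Rightarrow> 'f) set"
  have \<Psi>0: "\<gamma> = 0" if "\<gamma> \<in> ?Q" "\<Psi> \<gamma> = 0" for \<gamma>
  proof (intro ext)
    fix y j
    have "(\<Sum>y\<in>Y. scale (\<gamma> y j) y) = 0" using that(2) \<Psi>_apply[of \<gamma> j] by simp
    then have "\<gamma> y j = 0" if "y \<in> Y"
      using independentD[OF Y(2,1) subset_refl, of "\<lambda>y. \<gamma> y j"] that by simp
    then show "\<gamma> y j = 0 y j" using tuple_in(2)[OF that(1) subset_refl, of y] by (cases "y \<in> Y") auto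
  qed
  have \<Psi>inj: "\<gamma> = \<delta>" if "\<gamma> \<in> ?Q" "\<delta> \<in> ?Q" "\<Psi> \<gamma> = \<Psi> \<delta>" for \<gamma> \<delta>
  proof -
    have "\<gamma> - \<delta> \<in> ?Q" using that Q.F.subspace_diff[OF Q.subspace_prod_space[of Y "\<lambda>_. UNIV"]] by simp
    moreover have "\<Psi> (\<gamma> - \<delta>) = 0" using that(3) by (simp add: QF.linear_diff[OF lin\<Psi>])
    ultimately show ?thesis using \<Psi>0[of "\<gamma> - \<delta>"] by simp
  qed
  let ?P = "prod_space Y C"
  have PQ: "?P \<subseteq> ?Q" by (auto simp: prod_space_def)
  have subP: "Q.F.subspace ?P" by (rule Q.subspace_prod_space) (rule subC)
  have dP: "Q.F.fin_gen ?P" "Q.F.dim ?P = (\<Sum>y\<in>Y. S.F.dim (C y))"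
    using Q.prod_space_dim[OF Y(1), of C] subC fC[OF CE] by auto
  have \<Psi>K: "\<Psi> ` ?P \<subseteq> K"
  proof (rule image_subsetI)
    fix \<gamma> assume \<gamma>: "\<gamma> \<in> ?P"
    have g: "\<gamma> y \<in> C y" if "y \<in> Y" for y using prod_spaceD(1)[OF \<gamma> that] .
    have "\<Psi> \<gamma> \<in> T" unfolding \<Psi>_def using g by (intro F.subspace_sum[OF T(1)]) (auto simp: C_def)
    moreover have "\<Psi> \<gamma> j0 = 0" unfolding \<Psi>_apply
    proof (rule sum.neutral, rule ballI)
      fix y assume "y \<in> Y"
      then have "\<gamma> y j0 = 0" using g tuple_in(2)[OF _ CE, of "\<gamma> y" y j0] by simp
      then show "scale (\<gamma> y j0) y = 0" by simp
    qed
    ultimately show "\<Psi> \<gamma> \<in> K" by (simp add: K_def)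
  qed
  have d\<Psi>: "F.dim (\<Psi> ` ?P) = (\<Sum>y\<in>Y. S.F.dim (C y))"
    using QF.dim_injective_image[OF lin\<Psi> subP dP(1)] \<Psi>0 PQ dP(2) by (metis subsetD)
  have le: "(\<Sum>y\<in>Y. S.F.dim (C y)) + 1 \<le> q * m"
    using F.dim_mono_fin_gen[OF fT[OF KT] \<Psi>K] d\<Psi> dK by simp
  have "q \<noteq> 0" using dK by (cases "q = 0") auto
  then obtain r where r: "q = Suc r" by (metis not0_implies_Suc)
  have dC': "r \<le> S.F.dim (C y)" if "y \<noteq> 0" for y using dC[OF that] r by simp
  have ge: "Suc m * r \<le> (\<Sum>y\<in>Y. S.F.dim (C y))"
    using sum_bounded_below[of Y r "\<lambda>y. S.F.dim (C y)"] dC' Y0 Y(4) m by simp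
  have "Suc m * r + 1 \<le> q * m" using ge le by simp
  then have qm: "q = m" using mq r by simp
  have mr: "m = Suc r" using qm r by simp
  have \<Psi>eq: "\<Psi> ` ?P = K"
  proof (rule F.subspace_eq_of_dim_le[OF QF.linear_subspace_image[OF lin\<Psi> subP] fT[OF KT] \<Psi>K])
    show "F.dim K \<le> F.dim (\<Psi> ` ?P)" using ge d\<Psi> dK unfolding qm mr by simp
  qed
  have dCY: "S.F.dim (C y) = r" if y: "y \<in> Y" for y
  proof -
    have "(\<Sum>y\<in>Y. r) = (\<Sum>y\<in>Y. S.F.dim (C y))" using le ge Y(4) m unfolding qm mr by simp
    from sum_mono_inv[OF this _ y Y(1)] show ?thesis using dC' Y0 by simp
  qed
  have C_add: "C (y1 + y2) = C y1" if y: "y1 \<in> Y" "y2 \<in> Y" "y1 \<noteq> y2" for y1 y2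
  proof -
    have "y1 + y2 \<noteq> 0"
    proof
      assume "y1 + y2 = 0"
      then have "y1 = - y2" by (simp add: add_eq_0_iff2)
      moreover have "- y2 \<in> span (Y - {y1})" using y by (intro span_neg span_base) auto
      ultimately show False using Y(2) y(1) unfolding dependent_def by auto
    qed
    then have d: "S.F.dim (C y1) \<le> S.F.dim (C (y1 + y2))" using dC' dCY y(1) by simp
    have "C (y1 + y2) \<subseteq> C y1"
    proof
      fix c assume c: "c \<in> C (y1 + y2)"
      then have cE: "c \<in> ?E" and cT: "tensor c (y1 + y2) \<in> T" by (auto simp: C_def)
      have "c j0 = 0" using tuple_in(2)[OF cE subset_refl] by simp
      then have "tensor c (y1 + y2) \<in> K" using cT by (simp add: K_def tensor_def)
      then obtain \<gamma> where \<gamma>: "\<gamma> \<in> ?P" "\<Psi> \<gamma> = tensor c (y1 + y2)" using \<Psi>eq by (metis imageE)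
      define \<delta> :: "'v \<Rightarrow> 'j \<Rightarrow> 'f" where "\<delta> y = (if y = y1 \<or> y = y2 then c else 0)" for y
      have "\<Psi> \<delta> = tensor (\<delta> y1) y1 + (tensor (\<delta> y2) y2 + (\<Sum>y\<in>Y - {y1} - {y2}. tensor (\<delta> y) y))"
        unfolding \<Psi>_def using y Y(1) by (simp add: sum.remove[of Y y1] sum.remove[of "Y - {y1}" y2])
      also have "(\<Sum>y\<in>Y - {y1} - {y2}. tensor (\<delta> y) y) = 0"
        by (rule sum.neutral) (auto simp: \<delta>_def tensor_def zero_fun_def)
      also have "tensor (\<delta> y1) y1 + (tensor (\<delta> y2) y2 + 0) = tensor c (y1 + y2)"
        by (simp add: \<delta>_def tensor_def fun_eq_iff scale_right_distrib)
      finally have "\<Psi> \<delta> = tensor c (y1 + y2)" .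
      moreover have "\<delta> \<in> ?Q" using y by (intro prod_spaceI) (auto simp: \<delta>_def)
      ultimately have "\<gamma> = \<delta>" using \<gamma> PQ by (intro \<Psi>inj) auto
      then show "c \<in> C y1" using prod_spaceD(1)[OF \<gamma>(1) y(1)] by (simp add: \<delta>_def)
    qed
    then show ?thesis by (rule S.F.subspace_eq_of_dim_le[OF subC fC[OF CE] _ d])
  qed
  have "Y \<noteq> {}" using Y(4) m by auto
  then obtain y0 where y0: "y0 \<in> Y" by blast
  define D where "D = C y0"
  have CD: "C y = D" if "y \<in> Y" for y
    using C_add[OF that y0] C_add[OF y0 that] by (cases "y = y0") (auto simp: D_def add.commute)
  have D: "S.F.subspace D" "D \<subseteq> ?E" "S.F.dim D = r"
    unfolding D_def using subC CE dCY[OF y0] by auto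
  have tensorD: "tensor c v \<in> T" if "c \<in> D" for c v
  proof -
    interpret VF: vect_pair scale "fun_scale scale :: 'f \<Rightarrow> ('j \<Rightarrow> 'v) \<Rightarrow> 'j \<Rightarrow> 'v" ..
    have "Y \<subseteq> {v. tensor c v \<in> T}" using CD that by (auto simp: C_def)
    then have "span Y \<subseteq> {v. tensor c v \<in> T}"
      by (rule span_minimal) (rule VF.linear_subspace_linear_preimage[OF lin_tensor2 T(1)])
    then show ?thesis using Y(3) by auto
  qed

  have "\<exists>j1\<in>?J. single j1 1 \<notin> D"
  proof (rule ccontr)
    assume no: "\<not> ?thesis"
    have "c \<in> D" if c: "c \<in> ?E" for c
    proof -
      have "single j (c j) = fun_scale (*) (c j) (single j 1)" for j
        by (auto simp: single_def fun_scale_def)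
      then have "(\<Sum>j\<in>?J. single j (c j)) \<in> D"
        using no by (auto intro!: S.F.subspace_sum[OF D(1)] S.F.subspace_scale[OF D(1)])
      then show ?thesis using prod_space_sum_single[OF _ c] J(1) by simp
    qed
    then have "D = ?E" using D(2) by blast
    then show False using D(3) dE r by simp
  qed
  then obtain j1 where j1: "j1 \<in> ?J" "single j1 1 \<notin> D" by blast
  have single_E: "single j (1::'f) \<in> ?E" if "j \<in> ?J" for j
    using that by (auto intro!: prod_spaceI simp: single_def split: if_splits)
  have "\<exists>k. single j 1 - fun_scale (*) k (single j1 1) \<in> D" if j: "j \<in> ?J" for j
    by (rule S.F.hyperplane_decomp[OF D(1) fC[OF subset_refl] D(2) _ single_E[OF j1(1)] j1(2) single_E[OF j]])
      (use dE D(3) r in auto)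
  then obtain z' where z': "\<And>j. j \<in> ?J \<Longrightarrow> single j 1 - fun_scale (*) (z' j) (single j1 1) \<in> D" by metis
  \<comment> \<open>\<open>z j\<close> is the coordinate of \<open>single j 1\<close> modulo \<open>D\<close> along \<open>single j1 1\<close>\<close>
  define z where "z j = (if j = j1 then 1 else z' j)" for j
  define e where "e j = single j 1 - fun_scale (*) (z j) (single j1 1)" for j
  have e: "e j \<in> D" if "j \<in> ?J" for j
  proof (cases "j = j1")
    case True
    then have "e j = 0" by (auto simp: e_def z_def fun_scale_def fun_eq_iff)
    then show ?thesis using S.F.subspace_0[OF D(1)] by simp
  next
    case False
    then show ?thesis using z'[OF that] by (simp add: e_def z_def)
  qed
  define \<Phi> where "\<Phi> t = (\<Sum>j\<in>?J. scale (z j) (t j))" for t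
  \<comment> \<open>modulo \<open>T\<close>, a tuple is concentrated at \<open>j1\<close>, with value \<open>\<Phi> t\<close> there\<close>
  have red: "t - single j1 (\<Phi> t) \<in> T" if t: "t \<in> prod_space J (\<lambda>_. UNIV)" "t j0 = 0" for t
  proof -
    have "(\<Sum>j\<in>?J. tensor (e j) (t j)) = t - single j1 (\<Phi> t)"
    proof
      fix i
      have "(\<Sum>j\<in>?J. tensor (e j) (t j)) i = (\<Sum>j\<in>?J. scale (e j i) (t j))"
        by (simp add: sum_fun_apply tensor_def)
      also have "\<dots> = (\<Sum>j\<in>?J. (if i = j then t j else 0) - (if i = j1 then scale (z j) (t j) else 0))"
        by (rule sum.cong) (auto simp: e_def single_def fun_scale_def scale_left_diff_distrib)
      also have "\<dots> = (\<Sum>j\<in>?J. (if i = j then t j else 0)) - (if i = j1 then \<Phi> t else 0)"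
        by (auto simp: sum_subtractf \<Phi>_def)
      also have "(\<Sum>j\<in>?J. (if i = j then t j else 0)) = t i"
        using J(1) t(2) tuple_in(2)[OF t(1) subset_refl, of i] by auto
      finally show "(\<Sum>j\<in>?J. tensor (e j) (t j)) i = (t - single j1 (\<Phi> t)) i"
        by (auto simp: single_def)
    qed
    moreover have "(\<Sum>j\<in>?J. tensor (e j) (t j)) \<in> T"
      using e tensorD by (intro F.subspace_sum[OF T(1)]) auto
    ultimately show ?thesis by simp
  qed
  have single_T: "d = 0" if d: "single j1 d \<in> T" for d
  proof -
    have "single j1 d \<in> K" using d j1(1) by (auto simp: K_def single_def)
    then obtain \<gamma> where \<gamma>: "\<gamma> \<in> ?P" "\<Psi> \<gamma> = single j1 d" using \<Psi>eq by (metis imageE)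
    have "d \<in> span Y" using Y(3) by simp
    then obtain u where u: "d = (\<Sum>y\<in>Y. scale (u y) y)" using span_finite[OF Y(1)] by auto
    define \<delta> where "\<delta> y = (if y \<in> Y then fun_scale (*) (u y) (single j1 1) else 0)" for y
    have "\<Psi> \<delta> i = single j1 d i" for i
      unfolding \<Psi>_apply by (auto simp: \<delta>_def single_def fun_scale_def u intro!: sum.cong sum.neutral)
    then have "\<Psi> \<delta> = \<Psi> \<gamma>" using \<gamma>(2) by auto
    moreover have "\<delta> \<in> ?Q" by (intro prod_spaceI) (auto simp: \<delta>_def)
    ultimately have eq: "\<gamma> = \<delta>" using \<gamma>(1) PQ by (intro \<Psi>inj) auto
    have "u y = 0" if y: "y \<in> Y" for y
    proof (rule ccontr)
      assume "u y \<noteq> 0"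
      have "fun_scale (*) (u y) (single j1 1) \<in> D"
        using prod_spaceD(1)[OF \<gamma>(1) y] CD[OF y] y by (simp add: eq \<delta>_def)
      then have "fun_scale (*) (inverse (u y)) (fun_scale (*) (u y) (single j1 1)) \<in> D"
        by (rule S.F.subspace_scale[OF D(1)])
      then show False using j1(2) \<open>u y \<noteq> 0\<close> by simp
    qed
    then show ?thesis using u by simp
  qed
  show ?thesis
  proof (rule that[OF _ j1(1), of z])
    show "card J = dim UNIV" using q m qm by simp
    show "z j1 = 1" by (simp add: z_def)
    fix t :: "'j \<Rightarrow> 'v" assume t: "t \<in> prod_space J (\<lambda>_. UNIV)" "t j0 = 0"
    have "t \<in> T \<longleftrightarrow> \<Phi> t = 0"
    proof
      assume "t \<in> T"
      from F.subspace_diff[OF T(1) this red[OF t]] have "single j1 (\<Phi> t) \<in> T"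
        by (simp only: diff_diff_eq2 add_diff_cancel_left')
      then show "\<Phi> t = 0" by (rule single_T)
    next
      assume "\<Phi> t = 0"
      moreover have "single j1 (0::'v) = 0" by (auto simp: single_def)
      ultimately show "t \<in> T" using red[OF t] by simp
    qed
    then show "t \<in> T \<longleftrightarrow> (\<Sum>j\<in>J - {j0}. scale (z j) (t j)) = 0" by (simp add: \<Phi>_def)
  qed
qed

text \<open>
  By the previous lemma, \<open>\<Phi> t = \<Sum>j\<noteq>j0. z j * t j\<close> depends on \<open>t \<in> T\<close> only through \<open>t j0\<close>, so
  \<open>T = {t. \<Phi> t = \<beta> (t j0)}\<close> for a linear \<open>\<beta>\<close>, and \<open>a + T = {u. \<Phi> u = v0 + \<beta> (u j0)}\<close>. In such a \<open>u\<close>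
  the column \<open>j0\<close> is an arbitrary \<open>w\<close>, the columns other than \<open>j0\<close> and \<open>j1\<close> are arbitrary, and
  \<open>u j1\<close> is \<open>v0 + \<beta> w\<close> modulo those. If \<open>w\<close> and \<open>v0 + \<beta> w\<close> were independent for some \<open>w\<close>, one could
  fill in the other columns to a basis; so \<open>v0 + \<beta> w\<close> is always a multiple of \<open>w\<close>. When \<open>\<beta>\<close> is a
  scalar \<open>k\<close> and \<open>v0 = 0\<close>, the relation \<open>\<Phi> u = k u j0\<close> is a common linear dependency of the columns.
\<close>
lemma extremal_with_onto_column:
  fixes T :: "('j \<Rightarrow> 'v) set"
  assumes J: "finite J" "j0 \<in> J" "dim UNIV \<le> card J"
    and T: "F.subspace T" "T \<subseteq> prod_space J (\<lambda>_. UNIV)" and a: "a \<in> prod_space J (\<lambda>_. UNIV)"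
    and col: "(\<lambda>t. t j0) ` T = UNIV"
    and nospan: "\<And>t. t \<in> T \<Longrightarrow> span ((a + t) ` J) \<noteq> UNIV"
    and dT: "F.dim T + card J = card J * dim UNIV"
  shows "card J = dim UNIV \<and>
    ((\<exists>c. (\<exists>j\<in>J. c j \<noteq> 0) \<and> (\<forall>t\<in>T. (\<Sum>j\<in>J. scale (c j) ((a + t) j)) = 0)) \<or>
     (dim UNIV = 2 \<and> card (UNIV :: 'f set) = 2 \<and> a \<notin> T))"
proof -
  let ?J = "J - {j0}"
  obtain z j1 where n: "card J = dim UNIV" and j1: "j1 \<in> ?J" and zj1: "z j1 = 1"
    and ker: "\<And>t. t \<in> prod_space J (\<lambda>_. UNIV) \<Longrightarrow> t j0 = 0 \<Longrightarrow>
      t \<in> T \<longleftrightarrow> (\<Sum>j\<in>?J. scale (z j) (t j)) = 0"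
    by (rule kernel_is_functional[OF J T a col nospan dT]) (assumption, rule that)
  define \<Phi> where "\<Phi> t = (\<Sum>j\<in>?J. scale (z j) (t j))" for t
  have \<Phi>_add: "\<Phi> (s + t) = \<Phi> s + \<Phi> t" and \<Phi>_diff: "\<Phi> (s - t) = \<Phi> s - \<Phi> t"
    and \<Phi>_scale: "\<Phi> (fun_scale scale k t) = scale k (\<Phi> t)" for s t k
    unfolding \<Phi>_def
    by (simp_all add: scale_right_distrib scale_right_diff_distrib sum.distrib sum_subtractf
        fun_scale_def scale_sum_right mult.commute)
  have prod_diff: "s - t \<in> prod_space J (\<lambda>_. UNIV)"
    if "s \<in> prod_space J (\<lambda>_. UNIV)" "t \<in> prod_space J (\<lambda>_. UNIV)" for s t :: "'j \<Rightarrow> 'v"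
    using that by (intro F.subspace_diff subspace_prod_space) auto
  have "\<forall>w. \<exists>t\<in>T. t j0 = w" using col by (metis (mono_tags, lifting) UNIV_I imageE)
  then obtain \<tau> where \<tau>: "\<And>w. \<tau> w \<in> T" "\<And>w. \<tau> w j0 = w" by metis
  define \<beta> where "\<beta> w = \<Phi> (\<tau> w)" for w
  have inT: "\<Phi> t = \<beta> (t j0)" if t: "t \<in> T" for t
  proof -
    have d: "t - \<tau> (t j0) \<in> T" using t \<tau>(1) by (rule F.subspace_diff[OF T(1)])
    then have "t - \<tau> (t j0) \<in> prod_space J (\<lambda>_. UNIV)" using T(2) by blast
    then have "\<Phi> (t - \<tau> (t j0)) = 0" using ker d \<tau>(2) unfolding \<Phi>_def by simp
    then show ?thesis by (simp add: \<Phi>_diff \<beta>_def)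
  qed
  have T_if: "t \<in> T" if t: "t \<in> prod_space J (\<lambda>_. UNIV)" "\<Phi> t = \<beta> (t j0)" for t
  proof -
    have P: "t - \<tau> (t j0) \<in> prod_space J (\<lambda>_. UNIV)" using t(1) \<tau>(1) T(2) prod_diff by blast
    have "\<Phi> (t - \<tau> (t j0)) = 0" using t(2) by (simp add: \<Phi>_diff \<beta>_def)
    then have "t - \<tau> (t j0) \<in> T" using ker[OF P] \<tau>(2) unfolding \<Phi>_def by simp
    then have "t - \<tau> (t j0) + \<tau> (t j0) \<in> T" using \<tau>(1) by (rule F.subspace_add[OF T(1)])
    then show ?thesis by simp
  qed
  have lin: "Vector_Spaces.linear scale scale \<beta>"
  proof -
    have "\<beta> (v + w) = \<beta> v + \<beta> w" for v w
    proof -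
      have "\<tau> v + \<tau> w \<in> T" using \<tau>(1) by (intro F.subspace_add[OF T(1)])
      from inT[OF this] show ?thesis by (simp add: \<tau>(2) \<Phi>_add \<beta>_def)
    qed
    moreover have "\<beta> (scale k w) = scale k (\<beta> w)" for k w
    proof -
      have "fun_scale scale k (\<tau> w) \<in> T" using \<tau>(1) by (intro F.subspace_scale[OF T(1)])
      from inT[OF this] show ?thesis by (simp only: \<Phi>_scale \<beta>_def) (simp add: fun_scale_def \<tau>(2))
    qed
    ultimately show ?thesis by (simp add: Vector_Spaces.linear_iff vector_space_axioms)
  qed
  interpret \<beta>: Vector_Spaces.linear scale scale \<beta> by (rule lin)
  define v0 where "v0 = \<Phi> a - \<beta> (a j0)"
  have fJ: "finite ?J" "j0 \<noteq> j1" "j1 \<in> J" using J(1) j1 by auto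
  have ev: "v0 + \<beta> w \<in> span {w}" if w: "w \<noteq> 0" for w
  proof (rule ccontr)
    define x where "x = v0 + \<beta> w"
    assume "v0 + \<beta> w \<notin> span {w}"
    then have x: "x \<notin> span {w}" by (simp add: x_def)
    then have xw: "x \<noteq> w" using span_base by blast
    have ind: "independent {x, w}" using x w by (intro independent_insertI independent_empty) auto
    obtain B where B: "{x, w} \<subseteq> B" "independent B" "UNIV \<subseteq> span B"
      using maximal_independent_subset_extend[OF subset_UNIV ind] by metis
    have fB: "finite B" using independent_le_dim(1)[OF fin subset_UNIV B(2)] .
    have "card B = dim UNIV" using basis_card_eq_dim[OF subset_UNIV B(3,2)] .
    then have "card (B - {x, w}) = card (J - {j0, j1})"
      using B(1) xw J(2) fJ n by (simp add: card_Diff_subset)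
    then obtain h where h: "bij_betw h (J - {j0, j1}) (B - {x, w})"
      using finite_same_card_bij[of "J - {j0, j1}" "B - {x, w}"] J(1) fB by auto
    define s where "s = (\<Sum>j\<in>?J - {j1}. scale (z j) (h j))"
    define u where "u j = (if j = j0 then w else if j = j1 then x - s else if j \<in> J then h j else 0)" for j
    have uP: "u \<in> prod_space J (\<lambda>_. UNIV)" using J(2) fJ by (intro prod_spaceI) (auto simp: u_def)
    have "\<Phi> u = u j1 + (\<Sum>j\<in>?J - {j1}. scale (z j) (u j))"
      unfolding \<Phi>_def using zj1 by (simp add: sum.remove[OF fJ(1) j1])
    also have "(\<Sum>j\<in>?J - {j1}. scale (z j) (u j)) = s"
      unfolding s_def by (rule sum.cong) (auto simp: u_def)
    also have "u j1 + s = x" using fJ by (simp add: u_def)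
    finally have \<Phi>u: "\<Phi> u = x" .
    have uj0: "u j0 = w" by (simp add: u_def)
    have "\<Phi> (u - a) = \<beta> ((u - a) j0)"
      by (simp add: \<Phi>_diff \<Phi>u uj0 x_def v0_def \<beta>.diff)
    then have "u - a \<in> T" using T_if prod_diff[OF uP a] by blast
    then have "span ((a + (u - a)) ` J) \<noteq> UNIV" by (rule nospan)
    then have ns: "span (u ` J) \<noteq> UNIV" by simp
    have w_in: "w \<in> span (u ` J)" using J(2) uj0 by (metis imageI span_base)
    have h_in: "h j \<in> span (u ` J)" if "j \<in> J - {j0, j1}" for j
    proof -
      have "h j = u j" using that by (simp add: u_def)
      then show ?thesis using that by (simp add: span_base)
    qed
    have "u j1 + s \<in> span (u ` J)"
      unfolding s_def
    proof (intro span_add span_sum span_scale)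
      show "u j1 \<in> span (u ` J)" using fJ(3) by (simp add: span_base)
    qed (use h_in in auto)
    then have x_in: "x \<in> span (u ` J)" using fJ(2) by (simp add: u_def)
    have "b \<in> span (u ` J)" if "b \<in> B" for b
    proof (cases "b \<in> {x, w}")
      case True
      then show ?thesis using x_in w_in by auto
    next
      case False
      then have "b \<in> h ` (J - {j0, j1})" using h that by (simp add: bij_betw_def)
      then show ?thesis using h_in by auto
    qed
    then have "span B \<subseteq> span (u ` J)" by (intro span_minimal) auto
    then show False using ns B(3) by auto
  qed
  have "card {j0, j1} \<le> card J" using J fJ by (intro card_mono) auto
  then have two: "2 \<le> dim UNIV" using n fJ(2) by simp
  have "(v0 = 0 \<and> (\<exists>k. \<forall>w. \<beta> w = scale k w)) \<or> (v0 \<noteq> 0 \<and> dim UNIV = 2 \<and> card (UNIV :: 'f set) = 2)"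
    by (rule scalar_or_two_elements[OF fin two lin]) (rule ev)
  then have "(\<exists>c. (\<exists>j\<in>J. c j \<noteq> 0) \<and> (\<forall>t\<in>T. (\<Sum>j\<in>J. scale (c j) ((a + t) j)) = 0)) \<or>
     (dim UNIV = 2 \<and> card (UNIV :: 'f set) = 2 \<and> a \<notin> T)"
  proof (elim disjE conjE exE)
    fix k assume v0: "v0 = 0" and k: "\<forall>w. \<beta> w = scale k w"
    define c where "c j = (if j = j0 then - k else z j)" for j
    have "c j1 \<noteq> 0" using fJ(2) zj1 by (auto simp: c_def)
    moreover have "(\<Sum>j\<in>J. scale (c j) ((a + t) j)) = 0" if t: "t \<in> T" for t
    proof -
      have "\<Phi> (a + t) = \<beta> ((a + t) j0)" using v0 inT[OF t] by (simp add: \<Phi>_add v0_def \<beta>.add)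
      moreover have "(\<Sum>j\<in>J. scale (c j) ((a + t) j)) = scale (- k) ((a + t) j0) + \<Phi> (a + t)"
        unfolding \<Phi>_def sum.remove[OF J(1,2)] by (auto simp: c_def intro!: sum.cong)
      ultimately show ?thesis using k by simp
    qed
    ultimately show ?thesis using fJ(3) by blast
  next
    assume v0: "v0 \<noteq> 0" and "dim UNIV = 2" "card (UNIV :: 'f set) = 2"
    moreover have "a \<notin> T" using inT[of a] v0 by (auto simp: v0_def)
    ultimately show ?thesis by blast
  qed
  then show ?thesis using n by blast
qed

end

section \<open>Operators as tuples over a basis\<close>

locale operators = U: vect sU + fin_tuples sV "TYPE('u)"
  for sU :: "'f::field \<Rightarrow> 'u::ab_group_add \<Rightarrow> 'u" and sV :: "'f \<Rightarrow> 'v::ab_group_add \<Rightarrow> 'v" +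
  assumes U_fin: "U.fin_gen UNIV"
begin

sublocale UV: vect_pair sU sV ..

definition restr :: "'u set \<Rightarrow> ('u \<Rightarrow> 'v) \<Rightarrow> 'u \<Rightarrow> 'v"
  where "restr B t = (\<lambda>b. if b \<in> B then t b else 0)"

lemma linear_restr: "Vector_Spaces.linear (fun_scale sV) (fun_scale sV) (restr B)"
  unfolding Vector_Spaces.linear_iff
  by (auto simp: restr_def fun_scale_def fun_eq_iff F.vector_space_axioms)

lemma restr_in: "restr B t \<in> prod_space B (\<lambda>_. UNIV)"
  by (rule prod_spaceI) (auto simp: restr_def)

definition U_basis :: "'u set \<Rightarrow> bool"
  where "U_basis B \<longleftrightarrow> finite B \<and> U.independent B \<and> U.span B = UNIV \<and> card B = U.dim UNIV"

lemma U_basis_extend: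
  assumes "U.independent A"
  obtains B where "A \<subseteq> B" "U_basis B"
proof -
  obtain B where B: "A \<subseteq> B" "U.independent B" "UNIV \<subseteq> U.span B"
    using U.maximal_independent_subset_extend[OF subset_UNIV assms] by metis
  have "finite B" using U.independent_le_dim(1)[OF U_fin subset_UNIV B(2)] .
  moreover have "card B = U.dim UNIV" using U.basis_card_eq_dim[OF subset_UNIV B(3,2)] .
  ultimately show ?thesis using that[of B] B by (auto simp: U_basis_def)
qed

lemma HomD: "t \<in> Hom sU sV \<Longrightarrow> Vector_Spaces.linear sU sV t"
  by (simp add: Hom_def)

lemma Hom_add: "s \<in> Hom sU sV \<Longrightarrow> t \<in> Hom sU sV \<Longrightarrow> s + t \<in> Hom sU sV"
  using F.subspace_add[OF subspace_Hom] U.vector_space_axioms vector_space_axioms by blast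

lemma range_eq_span:
  assumes "U_basis B" "t \<in> Hom sU sV"
  shows "range t = span (t ` B)"
  using UV.linear_span_image[OF HomD[OF assms(2)], of B] assms(1) by (simp add: U_basis_def)

lemma restr_inj:
  assumes B: "U_basis B" and t: "t \<in> Hom sU sV" and 0: "restr B t = 0"
  shows "t = 0"
proof -
  have "t b = 0" if "b \<in> B" for b using fun_cong[OF 0, of b] that by (simp add: restr_def)
  then show ?thesis using UV.linear_eq_0_on_span[OF HomD[OF t], of B] B by (auto simp: U_basis_def)
qed

lemma fin_gen_Hom: "F.fin_gen (Hom sU sV)"
proof -
  obtain B where B: "U_basis B" using U_basis_extend[OF U.independent_empty] by metis
  have s: "F.subspace (Hom sU sV)" by (rule subspace_Hom) unfold_locales
  have "restr B ` Hom sU sV \<subseteq> prod_space B (\<lambda>_. UNIV)" using restr_in by auto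
  then have "F.fin_gen (restr B ` Hom sU sV)"
    using B by (intro fin_gen_tuples[where W = UNIV]) (auto simp: U_basis_def)
  moreover have "{t \<in> Hom sU sV. restr B t = 0} \<subseteq> {0}" using restr_inj[OF B] by auto
  then have "F.fin_gen {t \<in> Hom sU sV. restr B t = 0}"
    unfolding F.fin_gen_def by (intro exI[of _ "{}"]) auto
  ultimately show ?thesis by (intro FF.fin_gen_of_kernel_image[OF linear_restr s])
qed

text \<open>
  Restriction to a basis carries an affine space of operators to one of tuples, preserving its
  dimension and turning surjectivity into the spanning property.
\<close>
lemma restr_tuples:
  assumes B: "U_basis B" and T: "F.subspace T" "T \<subseteq> Hom sU sV" and a: "a \<in> Hom sU sV"
    and ns: "\<And>t. t \<in> T \<Longrightarrow> range (a + t) \<noteq> UNIV"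
  shows "F.subspace (restr B ` T)" "F.dim (restr B ` T) = F.dim T"
    "restr B ` T \<subseteq> prod_space B (\<lambda>_. UNIV)"
    "\<And>s. s \<in> restr B ` T \<Longrightarrow> span ((restr B a + s) ` B) \<noteq> UNIV"
proof -
  show "F.subspace (restr B ` T)" by (rule FF.linear_subspace_image[OF linear_restr T(1)])
  show "F.dim (restr B ` T) = F.dim T"
    using FF.dim_injective_image[OF linear_restr T(1) F.fin_gen_mono[OF fin_gen_Hom T(2)]]
      restr_inj[OF B] T(2) by blast
  show "restr B ` T \<subseteq> prod_space B (\<lambda>_. UNIV)" using restr_in by auto
  fix s assume "s \<in> restr B ` T"
  then obtain t where t: "t \<in> T" "s = restr B t" by blast
  have "a + t \<in> Hom sU sV" using a t(1) T(2) Hom_add by blast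
  then have "range (a + t) = span ((a + t) ` B)" by (rule range_eq_span[OF B])
  moreover have "(restr B a + s) ` B = (a + t) ` B" by (auto simp: t(2) restr_def)
  ultimately show "span ((restr B a + s) ` B) \<noteq> UNIV" using ns[OF t(1)] by simp
qed

section \<open>The two kinds of extremal spaces\<close>

text \<open>
  Write \<open>H x = {t x | t \<in> T}\<close>. Over a basis \<open>B\<close>, \<open>T\<close> embeds in the product of the proper subspaces
  \<open>H b\<close>, and the dimension forces it to be that product with every \<open>H b\<close> a hyperplane. Therefore
  \<open>H (b + c)\<close> contains \<open>H b\<close> and \<open>H c\<close>; it is proper as well, so \<open>H b = H c\<close>. Thus \<open>T\<close> consists of
  all operators with range in one hyperplane \<open>G\<close>. If \<open>a\<close> did not map into \<open>G\<close>, say \<open>a b0 \<notin> G\<close>, one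
  could correct \<open>a\<close> on the other basis vectors to span \<open>G\<close> there, up to multiples of \<open>a b0\<close>, and get
  a surjective operator.
\<close>
lemma extremal_without_onto_vector:
  assumes T: "F.subspace T" "T \<subseteq> Hom sU sV" and a: "a \<in> Hom sU sV"
    and ns: "\<And>t. t \<in> T \<Longrightarrow> range (a + t) \<noteq> UNIV"
    and le: "dim UNIV \<le> U.dim UNIV" and n: "dim UNIV = Suc m" and dT: "F.dim T = U.dim UNIV * m"
    and no_onto: "\<And>x. (\<lambda>t. t x) ` T \<noteq> UNIV"
  obtains H where "subspace H" "dim H = m" "\<And>t. t \<in> T \<Longrightarrow> range (a + t) \<subseteq> H"
proof -
  obtain B where B: "U_basis B" using U_basis_extend[OF U.independent_empty] by metis
  then have fB: "finite B" and cB: "card B = U.dim UNIV" by (auto simp: U_basis_def)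
  note R = restr_tuples[OF B T a ns]
  define H where "H x = (\<lambda>t. t x) ` T" for x
  have subH: "subspace (H x)" for x
    unfolding H_def by (rule FV.linear_subspace_image[OF linear_eval T(1)])
  have dH: "dim (H x) \<le> m" for x
  proof (rule ccontr)
    assume "\<not> dim (H x) \<le> m"
    then have "H x = UNIV" using subspace_eq_of_dim_le[OF subH fin subset_UNIV] n by simp
    then show False using no_onto by (simp add: H_def)
  qed
  have sub: "restr B ` T \<subseteq> prod_space B H"
    by (auto intro!: prod_spaceI simp: restr_def H_def)
  note PH = prod_space_dim[OF fB, of H, OF subH fin_gen]
  have "card B * m \<le> (\<Sum>b\<in>B. dim (H b))"
    using F.dim_mono_fin_gen[OF PH(1) sub] R(2) dT cB PH(2) by simp
  moreover have "(\<Sum>b\<in>B. dim (H b)) \<le> card B * m"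
    using sum_bounded_above[of B "\<lambda>b. dim (H b)" m] dH by simp
  ultimately have sm: "(\<Sum>b\<in>B. dim (H b)) = (\<Sum>b\<in>B. m)" by simp
  have dHB: "dim (H b) = m" if "b \<in> B" for b using sum_mono_inv[OF sm dH that fB] .
  have eq: "restr B ` T = prod_space B H"
    using R(1) PH sub R(2) dT cB sm by (intro F.subspace_eq_of_dim_le) auto
  have H_add: "H (b + c) = H b" if bc: "b \<in> B" "c \<in> B" "b \<noteq> c" for b c
  proof -
    have "H b \<subseteq> H (b + c)"
    proof
      fix h assume h: "h \<in> H b"
      have "single b h \<in> prod_space B H"
        using h bc subH subspace_0 by (auto intro!: prod_spaceI simp: single_def)
      then obtain t where t: "t \<in> T" "single b h = restr B t" using eq by (metis imageE)
      have "t b = h" "t c = 0"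
        using fun_cong[OF t(2), of b] fun_cong[OF t(2), of c] bc by (auto simp: restr_def single_def)
      then have "t (b + c) = h" using UV.linear_add[OF HomD] t(1) T(2) by (metis add.right_neutral subsetD)
      then show "h \<in> H (b + c)" using t(1) by (auto simp: H_def)
    qed
    then have "H b = H (b + c)"
      using dH[of "b + c"] dHB[OF bc(1)] by (intro subspace_eq_of_dim_le[OF subH fin_gen]) auto
    then show ?thesis by simp
  qed
  have "B \<noteq> {}" using le n cB by auto
  then obtain b1 where b1: "b1 \<in> B" by blast
  define G where "G = H b1"
  have HG: "H b = G" if "b \<in> B" for b
    using H_add[OF that b1] H_add[OF b1 that] by (cases "b = b1") (auto simp: G_def add.commute)
  have G: "subspace G" "dim G = m" unfolding G_def using subH dHB[OF b1] by auto
  have aG: "a b0 \<in> G" if b0: "b0 \<in> B" for b0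
  proof (rule ccontr)
    assume nG: "a b0 \<notin> G"
    have "\<exists>k. a b - sV k (a b0) \<in> G" for b
      by (rule hyperplane_decomp[OF G(1) fin subset_UNIV _ UNIV_I nG UNIV_I]) (use G n in auto)
    then obtain k where k: "\<And>b. a b - sV (k b) (a b0) \<in> G" by metis
    have "dim G \<le> card (B - {b0})" using G(2) le n cB fB b0 by simp
    then obtain M where M: "M \<in> prod_space (B - {b0}) (\<lambda>_. G)" "span (M ` (B - {b0})) = G"
      using spanning_tuple[OF _ G(1)] fB by (metis finite_Diff)
    \<comment> \<open>so that \<open>(a + s) b = M b\<close> up to a multiple of \<open>a b0\<close>\<close>
    define s where "s b = (if b \<in> B - {b0} then M b - (a b - sV (k b) (a b0)) else 0)" for b
    have sG: "s b \<in> G" for b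
      using k[of b] subspace_0[OF G(1)] tuple_in(1)[OF M(1) subset_refl, of b]
        subspace_diff[OF G(1), of "M b"] by (simp add: s_def)
    have "s b = 0" if "b \<notin> B" for b using that by (simp add: s_def)
    then have "s \<in> prod_space B H" using HG sG by (intro prod_spaceI) auto
    then have ns: "span ((restr B a + s) ` B) \<noteq> UNIV" using eq R(4) by simp
    let ?u = "restr B a + s" and ?L = "span ((restr B a + s) ` B)"
    have "?u b0 = a b0" using b0 by (simp add: restr_def s_def)
    then have ab0: "a b0 \<in> ?L" using b0 by (metis imageI span_base)
    have "M b \<in> ?L" if b: "b \<in> B - {b0}" for b
    proof -
      have "?u b = M b + sV (k b) (a b0)" using b by (simp add: restr_def s_def)
      then have "M b = ?u b - sV (k b) (a b0)" by simp
      moreover have "?u b \<in> ?L" using b by (intro span_base) auto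
      ultimately show ?thesis using span_diff[OF _ span_scale[OF ab0]] by metis
    qed
    then have "span (M ` (B - {b0})) \<subseteq> ?L" by (intro span_minimal) auto
    then have GL: "G \<subseteq> ?L" using M(2) by simp
    have "v \<in> ?L" for v
    proof -
      obtain c where "v - sV c (a b0) \<in> G"
        by (rule hyperplane_decomp[OF G(1) fin subset_UNIV _ UNIV_I nG UNIV_I]) (use G n in auto)
      then have "v - sV c (a b0) + sV c (a b0) \<in> ?L" using GL ab0 by (intro span_add span_scale) auto
      then show ?thesis by simp
    qed
    then show False using ns by auto
  qed
  show ?thesis
  proof (rule that[OF G])
    fix t assume t: "t \<in> T"
    have "a + t \<in> Hom sU sV" using a t T(2) Hom_add by blast
    moreover have "(a + t) b \<in> G" if "b \<in> B" for b
    proof -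
      have "t b \<in> G" using HG[OF that] t by (auto simp: H_def)
      then show ?thesis using aG[OF that] subspace_add[OF G(1)] by simp
    qed
    then have "span ((a + t) ` B) \<subseteq> G" by (intro span_minimal[OF _ G(1)]) auto
    ultimately show "range (a + t) \<subseteq> G" unfolding range_eq_span[OF B \<open>a + t \<in> Hom sU sV\<close>] by blast
  qed
qed

text \<open>
  Tuples over a basis that contains \<open>x\<close> have \<open>x\<close> as an onto column, and a linear dependency of the
  columns of \<open>u\<close> with coefficients \<open>c\<close> is a vector \<open>\<Sum>b. c b * b\<close> in the kernel of \<open>u\<close>.
\<close>
lemma extremal_with_onto_vector:
  assumes T: "F.subspace T" "T \<subseteq> Hom sU sV" and a: "a \<in> Hom sU sV"
    and ns: "\<And>t. t \<in> T \<Longrightarrow> range (a + t) \<noteq> UNIV"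
    and le: "dim UNIV \<le> U.dim UNIV" and dT: "F.dim T + U.dim UNIV = U.dim UNIV * dim UNIV"
    and onto: "(\<lambda>t. t x) ` T = UNIV" and x: "x \<noteq> 0"
  shows "U.dim UNIV = dim UNIV \<and>
    ((\<exists>y. y \<noteq> 0 \<and> (\<forall>t\<in>T. (a + t) y = 0)) \<or>
     (dim UNIV = 2 \<and> card (UNIV :: 'f set) = 2 \<and> a \<notin> T))"
proof -
  obtain B where B: "{x} \<subseteq> B" "U_basis B" using U_basis_extend[of "{x}"] x by auto
  then have fB: "finite B" and cB: "card B = U.dim UNIV" and iB: "U.independent B"
    by (auto simp: U_basis_def)
  note R = restr_tuples[OF B(2) T a ns]
  have xB: "x \<in> B" using B(1) by simp
  have col: "(\<lambda>t. t x) ` restr B ` T = UNIV"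
    using onto xB unfolding image_image by (simp add: restr_def)
  have "dim UNIV \<le> card B" "F.dim (restr B ` T) + card B = card B * dim UNIV"
    using le dT cB R(2) by auto
  from extremal_with_onto_column[OF fB xB this(1) R(1,3) restr_in col R(4) this(2)]
  have n: "U.dim UNIV = dim UNIV" and
    "(\<exists>c. (\<exists>j\<in>B. c j \<noteq> 0) \<and> (\<forall>t\<in>restr B ` T. (\<Sum>j\<in>B. sV (c j) ((restr B a + t) j)) = 0)) \<or>
     (dim UNIV = 2 \<and> card (UNIV :: 'f set) = 2 \<and> restr B a \<notin> restr B ` T)"
    using cB by auto
  then have "(\<exists>y. y \<noteq> 0 \<and> (\<forall>t\<in>T. (a + t) y = 0)) \<or>
     (dim UNIV = 2 \<and> card (UNIV :: 'f set) = 2 \<and> a \<notin> T)"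
  proof (elim disjE exE conjE bexE)
    fix c j assume j: "j \<in> B" "c j \<noteq> 0"
      and c: "\<forall>t\<in>restr B ` T. (\<Sum>j\<in>B. sV (c j) ((restr B a + t) j)) = 0"
    define y where "y = (\<Sum>b\<in>B. sU (c b) b)"
    have "y \<noteq> 0" using U.independentD[OF iB fB subset_refl _ j(1), of c] j(2) by (auto simp: y_def)
    moreover have "(a + t) y = 0" if t: "t \<in> T" for t
    proof -
      have h: "a + t \<in> Hom sU sV" using a t T(2) Hom_add by blast
      have "(a + t) y = (\<Sum>b\<in>B. sV (c b) ((a + t) b))"
        unfolding y_def UV.linear_sum[OF HomD[OF h]] UV.linear_scale[OF HomD[OF h]] ..
      also have "\<dots> = (\<Sum>b\<in>B. sV (c b) ((restr B a + restr B t) b))"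
        by (rule sum.cong) (auto simp: restr_def)
      finally show ?thesis using c t by simp
    qed
    ultimately show ?thesis by blast
  qed auto
  then show ?thesis using n by blast
qed

end

theorem theorem2p1:
  fixes sU :: "'f::field \<Rightarrow> 'u::ab_group_add \<Rightarrow> 'u"
    and sV :: "'f \<Rightarrow> 'v::ab_group_add \<Rightarrow> 'v"
    and BU :: "'u set" and BV :: "'v set"
    and p n :: nat
    and S :: "('u \<Rightarrow> 'v) set"
  assumes "finite_dimensional_vector_space sU BU"
    and "finite_dimensional_vector_space sV BV"
    and "vector_space.dim sU (UNIV :: 'u set) = p"
    and "vector_space.dim sV (UNIV :: 'v set) = n"
    and "p \<ge> n"
    and "affine_subspace_of (fun_scale sV) (Hom sU sV) S"
    and "\<forall>u\<in>S. vector_space.dim sV (range u) \<noteq> n"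
  shows "affine_dim (fun_scale sV) S \<le> p * (n - 1) \<and>
    (affine_dim (fun_scale sV) S = p * (n - 1) \<longrightarrow>
      (\<exists>H. linear_hyperplane sV H \<and> (\<forall>u\<in>S. range u \<subseteq> H)) \<or>
      (n = p \<and> (\<exists>x. x \<noteq> 0 \<and> (\<forall>u\<in>S. u x = 0))) \<or>
      (n = 2 \<and> p = 2 \<and> card (UNIV :: 'f set) = 2 \<and> \<not> module.subspace (fun_scale sV) S))"
proof -
  interpret U: finite_dimensional_vector_space sU BU by fact
  interpret V: finite_dimensional_vector_space sV BV by fact
  interpret U: vect sU ..
  interpret V: vect sV ..
  interpret operators sU sV
  proof
    show "V.fin_gen UNIV" unfolding V.fin_gen_def using V.finite_Basis V.span_Basis by blast
    show "U.fin_gen UNIV" unfolding U.fin_gen_def using U.finite_Basis U.span_Basis by blast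
  qed
  obtain a T where a: "a \<in> Hom sU sV" and T: "F.subspace T" "T \<subseteq> Hom sU sV" and S: "S = (+) a ` T"
    using assms(6) unfolding affine_subspace_of_def by blast
  have dS: "affine_dim (fun_scale sV) S = F.dim T"
    unfolding affine_dim_def S by (simp add: translation_space_eq[OF F.vector_space_axioms T(1)])
  have ns: "range (a + t) \<noteq> UNIV" if "t \<in> T" for t
    using assms(4,7) that unfolding S by fastforce
  have "n \<noteq> 0"
  proof
    assume "n = 0"
    then have "V.dim (range (a + 0)) = 0"
      using V.dim_mono_fin_gen[OF fin subset_UNIV, of "range (a + 0)"] assms(4) by simp
    moreover have "a + 0 \<in> S" unfolding S using F.subspace_0[OF T(1)] by blast
    ultimately show False using assms(7) \<open>n = 0\<close> by blast
  qed
  then obtain m where m: "n = Suc m" by (metis not0_implies_Suc)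
  obtain B where B: "U_basis B" using U_basis_extend[OF U.independent_empty] by metis
  then have fB: "finite B" and cB: "card B = p" using assms(3) by (auto simp: U_basis_def)
  note R = restr_tuples[OF B T a ns]
  have "F.dim (restr B ` T) + card B \<le> card B * V.dim UNIV"
    by (rule codim_bound[OF fB V.subspace_UNIV _ R(1,3) restr_in R(4)]) (use assms(4,5) cB in auto)
  then have bound: "F.dim T \<le> p * m" using R(2) cB assms(4) m by simp
  moreover have "(\<exists>H. linear_hyperplane sV H \<and> (\<forall>u\<in>S. range u \<subseteq> H)) \<or>
      (n = p \<and> (\<exists>x. x \<noteq> 0 \<and> (\<forall>u\<in>S. u x = 0))) \<or>
      (n = 2 \<and> p = 2 \<and> card (UNIV :: 'f set) = 2 \<and> \<not> module.subspace (fun_scale sV) S)"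
    if dT: "F.dim T = p * m"
  proof (cases "\<exists>x. (\<lambda>t. t x) ` T = UNIV")
    case True
    then obtain x where x: "(\<lambda>t. t x) ` T = UNIV" by blast
    have "x \<noteq> 0"
    proof
      assume "x = 0"
      then have "t x = 0" if "t \<in> T" for t using UV.linear_0[OF HomD] T(2) that by auto
      then have "(\<lambda>t. t x) ` T \<subseteq> {0}" by auto
      then have "(UNIV :: 'v set) = {0}" unfolding x by auto
      then have "V.dim UNIV = 0" by (metis V.dim_eq_0 order_refl)
      then show False using assms(4) m by simp
    qed
    moreover have "V.dim UNIV \<le> U.dim UNIV" "F.dim T + U.dim UNIV = U.dim UNIV * V.dim UNIV"
      using assms(3-5) dT m by auto
    ultimately have *: "p = n \<and>
      ((\<exists>y. y \<noteq> 0 \<and> (\<forall>t\<in>T. (a + t) y = 0)) \<or> (n = 2 \<and> card (UNIV :: 'f set) = 2 \<and> a \<notin> T))"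
      using extremal_with_onto_vector[OF T a ns _ _ x] assms(3,4) by simp
    have "a \<in> T" if "F.subspace S"
    proof -
      have "0 \<in> S" using F.subspace_0[OF that] .
      then obtain t where t: "t \<in> T" "a + t = 0" unfolding S by auto
      then have "a = - t" by (simp add: add_eq_0_iff2)
      then show ?thesis using F.subspace_neg[OF T(1) t(1)] by simp
    qed
    then show ?thesis using * unfolding S by auto
  next
    case False
    have "V.dim UNIV \<le> U.dim UNIV" "V.dim UNIV = Suc m" "F.dim T = U.dim UNIV * m"
      using assms(3-5) dT m by auto
    then obtain H where "V.subspace H" "V.dim H = m" "\<And>t. t \<in> T \<Longrightarrow> range (a + t) \<subseteq> H"
      using extremal_without_onto_vector[OF T a ns] False by metis
    then have "linear_hyperplane sV H \<and> (\<forall>u\<in>S. range u \<subseteq> H)"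
      using assms(4) m unfolding linear_hyperplane_def S by auto
    then show ?thesis by blast
  qed
  ultimately show ?thesis using dS m by simp
qed

end
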